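(* Let $c>0$, let $X=(X_n)_{n\in\mathbb{Z}_+}$ be the once-reinforced random walk on $\mathbb{Z}_+=\{0,1,2,\ldots\}$ with parameter $c$ started at $X_0=0$, and let $R_n:=\max\{X_0,X_1,\ldots,X_n\}$. For $\ell=1,2,\ldots$ put $$J_{\ell}(c):=2^{c}\int_{0}^{\infty}x^{\ell-1}\left(\frac{e^{x}}{e^{2x}+1}\right)^{c}dx.$$ Then for every $\ell=1,2,\ldots$, as $n\to\infty$, $$\mathbb{E}\left[\left(\frac{R_{n}}{\sqrt{n}}\right)^{\ell}\right]\sim\frac{1}{2^{(\ell-2)/2}\,\Gamma(\ell/2)}\cdot J_{\ell}(c).$$ In particular, $$\mathbb{E}\left[\frac{R_{n}}{\sqrt{n}}\right]\sim\sqrt{\frac{2}{\pi}}\,J_{1}(c)\quad\text{and}\quad\mathbb{E}\left[\frac{R_{n}^{2}}{n}\right]\sim J_{2}(c).$$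
   Context: Once-reinforced random walk (ORRW) on $\mathbb{Z}_+$ with parameter $c>0$: a $\mathbb{Z}_+$-valued process $X=(X_n)_{n\in\mathbb{Z}_+}$ with $X_0=0$ such that, writing $R_n:=\max\{X_0,\ldots,X_n\}$ and $\mathcal{F}_n:=\sigma(X_0,\ldots,X_n)$, for every $n\in\mathbb{Z}_+$, $$\mathbb{P}(X_{n+1}=X_n+1\mid\mathcal{F}_n)=1-\mathbb{P}(X_{n+1}=X_n-1\mid\mathcal{F}_n)=\begin{cases}1&\text{if }X_n=0,\\ \frac12&\text{if }0<X_n<R_n,\\ \frac{1}{1+c}&\text{if }X_n=R_n>0.\end{cases}$$ The notation $a_n\sim b_n$ means $a_n/b_n\to1$ as $n\to\infty$. $\Gamma$ is the Gamma function. *)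

theory Defs
  imports "HOL-Probability.Probability" "HOL-Library.Landau_Symbols"
begin

definition running_max :: "(nat \<Rightarrow> 'a \<Rightarrow> nat) \<Rightarrow> nat \<Rightarrow> 'a \<Rightarrow> nat" where
  "running_max X n \<omega> = Max ((\<lambda>i. X i \<omega>) ` {0..n})"

text \<open>Only the space and the measurable sets of this \<open>measure\<close> matter: as a second argument of
  \<^const>\<open>real_cond_exp\<close> it plays the role of a sub-\<open>\<sigma>\<close>-algebra.\<close>

definition natural_filtration :: "'a measure \<Rightarrow> (nat \<Rightarrow> 'a \<Rightarrow> nat) \<Rightarrow> nat \<Rightarrow> 'a measure" where
  "natural_filtration M X n = sigma (space M) (\<Union>i\<in>{0..n}. {X i -` A \<inter> space M | A. A \<in> UNIV})"

definition orrw_up_prob :: "real \<Rightarrow> nat \<Rightarrow> nat \<Rightarrow> real" where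
  "orrw_up_prob c x r = (if x = 0 then 1 else if x < r then 1 / 2 else 1 / (1 + c))"

text \<open>Conditional probabilities are conditional expectations of indicators, hence determined only
  almost everywhere. The down-step is compared in \<^typ>\<open>int\<close>, since subtraction on \<^typ>\<open>nat\<close>
  would turn \<open>X n - 1\<close> into \<open>0\<close> when the walk is at \<open>0\<close>.\<close>

locale once_reinforced_walk = prob_space M
  for M :: "'a measure" and X :: "nat \<Rightarrow> 'a \<Rightarrow> nat" and c :: real +
  assumes c_pos: "c > 0"
    and measurable_X: "\<And>n. X n \<in> measurable M (count_space UNIV)"
    and start: "AE \<omega> in M. X 0 \<omega> = 0"
    and step_up: "\<And>n. AE \<omega> in M.
      real_cond_exp M (natural_filtration M X n)
        (indicator {\<omega> \<in> space M. X (n + 1) \<omega> = X n \<omega> + 1}) \<omega>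
      = orrw_up_prob c (X n \<omega>) (running_max X n \<omega>)"
    and step_down: "\<And>n. AE \<omega> in M.
      1 - real_cond_exp M (natural_filtration M X n)
        (indicator {\<omega> \<in> space M. int (X (n + 1) \<omega>) = int (X n \<omega>) - 1}) \<omega>
      = orrw_up_prob c (X n \<omega>) (running_max X n \<omega>)"
begin

lemma subalgebra_natural_filtration: "subalgebra M (natural_filtration M X n)"
  unfolding subalgebra_def natural_filtration_def
  by (auto intro!: sets.sigma_sets_subset measurable_sets[OF measurable_X] simp: space_measure_of_conv
      sets_measure_of_conv)

end

definition orrw_J :: "nat \<Rightarrow> real \<Rightarrow> real" where
  "orrw_J l c = 2 powr c *
     (LINT x:{0<..}|lborel. x ^ (l - 1) * (exp x / (exp (2 * x) + 1)) powr c)"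

end

theory Submission
  imports Defs "HOL-Real_Asymp.Real_Asymp"
begin

text \<open>At the point \<open>1 / cosh u\<close>, the generating function of the hitting time of level \<open>k\<close> is
  the reciprocal of \<open>\<Prod>j<k. cosh u + c * tanh (u * j) * sinh u\<close>, because a multiple of \<open>cosh (u * x)\<close>
  depending only on the maximum is an eigenfunction of the walk together with its maximum. As
  \<open>u \<rightarrow> 0\<close> with \<open>u * k \<rightarrow> x\<close>, this product tends to \<open>cosh x powr c\<close>. Summing over the levels
  gives the limit of the Laplace transform of the increments of \<open>n \<mapsto> E (R n ^ l)\<close>, namely
  an integral that equals \<open>orrw_J l c\<close> up to a constant, and Karamata's Tauberian theorem turns it
  into the asymptotics of the moments.\<close>

section \<open>Karamata's Tauberian theorem\<close>

text \<open>Discounting by \<open>1 / cosh u\<close> per step amounts to the Laplace parameter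
  \<open>s = ln (cosh u)\<close>, which behaves like u^2 / 2 as u tends to 0. This is the source of
  the diffusive scaling: levels of order 1 / u correspond to times of order 1 / u^2, and normalising
  by s^(l/2) turns the factor u^l of the level sum into the 2^(-l/2) of the final constant. The
  parameter c enters only through the steps taken at the running maximum. Each level contributes a
  factor 1 + c * u * tanh (u * j) to first order in u, and the roughly x / u levels below x / u
  accumulate to the c-th power of cosh x. A limit of transforms does not by itself determine the
  growth of a sequence. The Tauberian step is legitimate because the maximum is nondecreasing in
  time, so that the moments have nonnegative increments. Finally, asymptotic equivalence to a
  constant needs that constant to be nonzero, hence the separate proof that
  \<open>orrw_J l c\<close> is positive.\<close>

lemma
  fixes \<rho> a :: real
  assumes "\<rho> > 0" "a > 0"
  shows set_integrable_powr_exp: "set_integrable lborel {0<..} (\<lambda>t. t powr (\<rho> - 1) * exp (- (a * t)))"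
    and set_integral_powr_exp:
      "(LINT t:{0<..}|lborel. t powr (\<rho> - 1) * exp (- (a * t))) = Gamma \<rho> / a powr \<rho>"
proof -
  let ?g = "\<lambda>t::real. indicator {0..} t * t powr (\<rho> - 1) / exp t"
  have "has_bochner_integral lborel ?g (Gamma \<rho>)"
    using assms by (intro has_bochner_integral_nn_integral)
      (auto simp: Gamma_conv_nn_integral_real less_imp_le)
  then have "has_bochner_integral lborel (\<lambda>t. ?g (0 + a * t)) (Gamma \<rho> /\<^sub>R \<bar>a\<bar>)"
    using assms by (subst (asm) lborel_has_bochner_integral_real_affine_iff[of a _ _ 0]) auto
  then have "has_bochner_integral lborel (\<lambda>t. a powr (1 - \<rho>) * ?g (0 + a * t))
      (a powr (1 - \<rho>) * (Gamma \<rho> /\<^sub>R \<bar>a\<bar>))"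
    by (intro has_bochner_integral_mult_right) auto
  moreover have "a powr (1 - \<rho>) * (Gamma \<rho> /\<^sub>R \<bar>a\<bar>) = Gamma \<rho> / a powr \<rho>"
    using assms by (simp add: powr_diff field_simps)
  moreover have "(\<lambda>t. a powr (1 - \<rho>) * ?g (0 + a * t)) =
      (\<lambda>t. indicator {0<..} t *\<^sub>R (t powr (\<rho> - 1) * exp (- (a * t))))"
    using assms by (intro ext)
      (auto simp: indicator_def powr_mult powr_diff exp_minus field_simps zero_le_mult_iff)
  ultimately show "set_integrable lborel {0<..} (\<lambda>t. t powr (\<rho> - 1) * exp (- (a * t)))"
    and "(LINT t:{0<..}|lborel. t powr (\<rho> - 1) * exp (- (a * t))) = Gamma \<rho> / a powr \<rho>"
    by (auto simp: set_integrable_def set_lebesgue_integral_def has_bochner_integral_iff)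
qed

lemma set_integrable_powr_exp_mult:
  fixes \<rho> :: real and h :: "real \<Rightarrow> real"
  assumes "\<rho> > 0" and [measurable]: "h \<in> borel_measurable borel"
    and bd: "\<And>x. x \<in> {0..1} \<Longrightarrow> \<bar>h x\<bar> \<le> B"
  shows "set_integrable lborel {0<..} (\<lambda>t. t powr (\<rho> - 1) * exp (- t) * h (exp (- t)))"
proof (rule set_integrable_bound)
  show "set_integrable lborel {0<..} (\<lambda>t. B * (t powr (\<rho> - 1) * exp (- (1 * t))))"
    using assms by (intro set_integrable_mult_right set_integrable_powr_exp) auto
  have "\<bar>h (exp (- t))\<bar> \<le> B" if "t > 0" for t
    using that by (intro bd) auto
  moreover have "B \<ge> 0" using bd[of 0] by auto
  ultimately show "AE t in lborel. t \<in> {0<..} \<longrightarrow> norm (t powr (\<rho> - 1) * exp (- t) * h (exp (- t)))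
      \<le> norm (B * (t powr (\<rho> - 1) * exp (- (1 * t))))"
    by (auto simp: abs_mult mult_ac intro!: mult_left_mono)
qed (auto simp: set_borel_measurable_def)

text \<open>The extra factor \<open>exp (- (s * n)) ^ m\<close> only replaces \<open>s\<close> by
  \<open>(m + 1) * s\<close>, so the limit is K / (m + 1)^\<rho>. The integral is the Gamma integral
  with rate m + 1 and yields the same power.\<close>

lemma laplace_moment_limit:
  fixes b :: "nat \<Rightarrow> real" and \<rho> K :: real
  assumes "\<rho> > 0"
    and lim: "((\<lambda>s. s powr \<rho> * (\<Sum>n. b n * exp (- (s * n)))) \<longlongrightarrow> K) (at_right 0)"
  shows "((\<lambda>s. s powr \<rho> * (\<Sum>n. b n * exp (- (s * n)) * exp (- (s * n)) ^ m)) \<longlongrightarrow>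
      K / Gamma \<rho> * (LINT t:{0<..}|lborel. t powr (\<rho> - 1) * exp (- t) * exp (- t) ^ m)) (at_right 0)"
proof -
  have g: "Gamma \<rho> > 0" using assms by (simp add: Gamma_real_pos)
  have "(LINT t:{0<..}|lborel. t powr (\<rho> - 1) * exp (- t) * exp (- t) ^ m)
      = (LINT t:{0<..}|lborel. t powr (\<rho> - 1) * exp (- ((real m + 1) * t)))"
    by (intro set_lebesgue_integral_cong)
      (auto simp: exp_of_nat_mult[symmetric] exp_add[symmetric] algebra_simps)
  also have "\<dots> = Gamma \<rho> / (real m + 1) powr \<rho>"
    using assms by (intro set_integral_powr_exp) auto
  finally have eq: "K / Gamma \<rho> * (LINT t:{0<..}|lborel. t powr (\<rho> - 1) * exp (- t) * exp (- t) ^ m)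
      = K / (real m + 1) powr \<rho>" using g by simp
  have "filterlim (\<lambda>s. (real m + 1) * s) (at_right 0) (at_right (0::real))"
    unfolding filterlim_at
    by (auto intro!: tendsto_eq_intros eventually_at_right_less[of 0, THEN eventually_mono])
  from filterlim_compose[OF lim this]
  have "((\<lambda>s. ((real m + 1) * s) powr \<rho> * (\<Sum>n. b n * exp (- ((real m + 1) * s * n))) / (real m + 1) powr \<rho>)
      \<longlongrightarrow> K / (real m + 1) powr \<rho>) (at_right 0)"
    by (rule tendsto_divide) auto
  moreover have "\<forall>\<^sub>F s in at_right 0.
      ((real m + 1) * s) powr \<rho> * (\<Sum>n. b n * exp (- ((real m + 1) * s * n))) / (real m + 1) powr \<rho>
      = s powr \<rho> * (\<Sum>n. b n * exp (- (s * n)) * exp (- (s * n)) ^ m)"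
  proof (rule eventually_mono[OF eventually_at_right_less[of 0]])
    fix s :: real assume s: "s > 0"
    have "exp (- ((real m + 1) * s * n)) = exp (- (s * n)) * exp (- (s * n)) ^ m" for n :: nat
      by (simp add: exp_of_nat_mult[symmetric] exp_add[symmetric] algebra_simps)
    then show "((real m + 1) * s) powr \<rho> * (\<Sum>n. b n * exp (- ((real m + 1) * s * n))) / (real m + 1) powr \<rho>
      = s powr \<rho> * (\<Sum>n. b n * exp (- (s * n)) * exp (- (s * n)) ^ m)"
      using s by (simp add: powr_mult mult.assoc)
  qed
  ultimately show ?thesis unfolding eq by (rule Lim_transform_eventually)
qed

text \<open>The variable \<open>x = exp (- (s * n))\<close> maps the half-line into the compact
  interval from 0 to 1, where Stone-Weierstrass reduces \<open>h\<close> to polynomials, that is, to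
  combinations of the powers treated before. The factor \<open>exp (- (s * n))\<close> left outside
  \<open>h\<close> keeps the mass finite: a uniform error e in \<open>h\<close> costs at most e
  times the original transform, which is bounded near 0 after normalisation.\<close>

lemma laplace_continuous_limit:
  fixes b :: "nat \<Rightarrow> real" and \<rho> K :: real and h :: "real \<Rightarrow> real"
  assumes \<rho>: "\<rho> > 0" and b: "\<And>n. b n \<ge> 0"
    and sm: "\<And>s. s > 0 \<Longrightarrow> summable (\<lambda>n. b n * exp (- (s * real n)))"
    and lim: "((\<lambda>s. s powr \<rho> * (\<Sum>n. b n * exp (- (s * n)))) \<longlongrightarrow> K) (at_right 0)"
    and h: "continuous_on UNIV h"
  shows "((\<lambda>s. s powr \<rho> * (\<Sum>n. b n * exp (- (s * n)) * h (exp (- (s * n))))) \<longlongrightarrow>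
      K / Gamma \<rho> * (LINT t:{0<..}|lborel. t powr (\<rho> - 1) * exp (- t) * h (exp (- t)))) (at_right 0)"
proof -
  define S where "S f s = s powr \<rho> * (\<Sum>n. b n * exp (- (s * n)) * f (exp (- (s * n))))" for f s
  define G where "G f = (LINT t:{0<..}|lborel. t powr (\<rho> - 1) * exp (- t) * f (exp (- t)))"
    for f :: "real \<Rightarrow> real"
  have g: "Gamma \<rho> > 0" using \<rho> by (rule Gamma_real_pos)
  have bdd: "\<exists>B. \<forall>x\<in>{0..1}. \<bar>f x\<bar> \<le> B" if "continuous_on UNIV f" for f :: "real \<Rightarrow> real"
  proof -
    have "bounded (f ` {0..1})"
      using that by (intro compact_imp_bounded compact_continuous_image) (auto intro: continuous_on_subset)
    then show ?thesis by (auto simp: bounded_iff)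
  qed
  have meas: "f \<in> borel_measurable borel" if "continuous_on UNIV f" for f :: "real \<Rightarrow> real"
    using that by (rule borel_measurable_continuous_onI)
  have intg: "set_integrable lborel {0<..} (\<lambda>t. t powr (\<rho> - 1) * exp (- t) * f (exp (- t)))"
    if "continuous_on UNIV f" for f :: "real \<Rightarrow> real"
    using bdd[OF that] meas[OF that] \<rho> by (auto intro!: set_integrable_powr_exp_mult)
  have summ: "summable (\<lambda>n. b n * exp (- (s * n)) * f (exp (- (s * n))))"
    if f: "continuous_on UNIV f" and s: "s > 0" for f and s :: real
  proof -
    obtain B where B: "\<forall>x\<in>{0..1}. \<bar>f x\<bar> \<le> B" using bdd[OF f] by blast
    have "\<bar>f (exp (- (s * real n)))\<bar> \<le> B" for n using B s by auto
    then show ?thesis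
      using b by (intro summable_comparison_test'[OF summable_mult2[OF sm[OF s], of B], of 0])
        (auto simp: abs_mult intro!: mult_left_mono)
  qed
  have close: "\<bar>S f s - S f' s\<bar> \<le> e * (s powr \<rho> * (\<Sum>n. b n * exp (- (s * n))))"
    if f: "continuous_on UNIV f" "continuous_on UNIV f'" and s: "s > 0"
      and e: "\<And>x. x \<in> {0..1} \<Longrightarrow> \<bar>f x - f' x\<bar> \<le> e" for f f' and s e :: real
  proof -
    let ?d = "\<lambda>n. b n * exp (- (s * real n)) * f (exp (- (s * n))) - b n * exp (- (s * real n)) * f' (exp (- (s * n)))"
    have le: "norm (?d n) \<le> b n * exp (- (s * real n)) * e" for n
    proof -
      have "?d n = b n * exp (- (s * real n)) * (f (exp (- (s * n))) - f' (exp (- (s * n))))"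
        by (simp add: algebra_simps)
      also have "norm \<dots> = b n * exp (- (s * real n)) * \<bar>f (exp (- (s * n))) - f' (exp (- (s * n)))\<bar>"
        using b by (simp add: abs_mult)
      also have "\<dots> \<le> b n * exp (- (s * real n)) * e"
        using b s by (intro mult_left_mono e) auto
      finally show ?thesis .
    qed
    have *: "S f s - S f' s = s powr \<rho> * (\<Sum>n. ?d n)"
      unfolding S_def right_diff_distrib[symmetric] suminf_diff[OF summ[OF f(1) s] summ[OF f(2) s]] ..
    have "\<bar>S f s - S f' s\<bar> = s powr \<rho> * norm (\<Sum>n. ?d n)"
      unfolding * by (simp only: abs_mult real_norm_def abs_of_nonneg[OF powr_ge_zero])
    also have "\<dots> \<le> s powr \<rho> * (\<Sum>n. b n * exp (- (s * real n)) * e)"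
      using le by (intro mult_left_mono norm_suminf_le summable_mult2 sm s) auto
    also have "(\<Sum>n. b n * exp (- (s * real n)) * e) = (\<Sum>n. b n * exp (- (s * real n))) * e"
      using suminf_mult2[OF sm[OF s], of e] by simp
    finally show ?thesis by (simp add: mult_ac)
  qed
  have closeG: "\<bar>G f - G f'\<bar> \<le> e * Gamma \<rho>"
    if f: "continuous_on UNIV f" "continuous_on UNIV f'"
      and e: "\<And>x. x \<in> {0..1} \<Longrightarrow> \<bar>f x - f' x\<bar> \<le> e" for f f' e
  proof -
    let ?w = "\<lambda>t::real. t powr (\<rho> - 1) * exp (- t)"
    have *: "G f - G f' = (LINT t:{0<..}|lborel. ?w t * f (exp (- t)) - ?w t * f' (exp (- t)))"
      unfolding G_def using intg[OF f(1)] intg[OF f(2)] by (subst set_integral_diff) auto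
    have "\<bar>G f - G f'\<bar> \<le> (LINT t:{0<..}|lborel. \<bar>?w t * f (exp (- t)) - ?w t * f' (exp (- t))\<bar>)"
      unfolding * using set_integral_norm_bound[OF set_integral_diff(1)[OF intg[OF f(1)] intg[OF f(2)]]] by simp
    also have "\<dots> \<le> (LINT t:{0<..}|lborel. e * (t powr (\<rho> - 1) * exp (- (1 * t))))"
    proof (rule set_integral_mono)
      show "set_integrable lborel {0<..} (\<lambda>t. \<bar>?w t * f (exp (- t)) - ?w t * f' (exp (- t))\<bar>)"
        by (intro set_integrable_abs set_integral_diff intg f)
      show "set_integrable lborel {0<..} (\<lambda>t. e * (t powr (\<rho> - 1) * exp (- (1 * t))))"
        using \<rho> by (intro set_integrable_mult_right set_integrable_powr_exp) auto
      fix t :: real assume "t \<in> {0<..}"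
      then have "\<bar>f (exp (- t)) - f' (exp (- t))\<bar> \<le> e" by (intro e) auto
      then have "?w t * \<bar>f (exp (- t)) - f' (exp (- t))\<bar> \<le> ?w t * e" by (intro mult_left_mono) auto
      then show "\<bar>?w t * f (exp (- t)) - ?w t * f' (exp (- t))\<bar> \<le> e * (t powr (\<rho> - 1) * exp (- (1 * t)))"
        unfolding right_diff_distrib[symmetric] abs_mult by (simp add: mult_ac)
    qed
    also have "\<dots> = e * Gamma \<rho>"
      using \<rho> set_integral_powr_exp[of \<rho> 1] by simp
    finally show ?thesis .
  qed
  have poly: "((\<lambda>s. S (\<lambda>x. \<Sum>i\<le>m. a i * x ^ i) s) \<longlongrightarrow> K / Gamma \<rho> * G (\<lambda>x. \<Sum>i\<le>m. a i * x ^ i)) (at_right 0)"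
    for a :: "nat \<Rightarrow> real" and m
  proof -
    have 1: "((\<lambda>s. \<Sum>i\<le>m. a i * S (\<lambda>x. x ^ i) s) \<longlongrightarrow> (\<Sum>i\<le>m. a i * (K / Gamma \<rho> * G (\<lambda>x. x ^ i)))) (at_right 0)"
      unfolding S_def G_def
      by (intro tendsto_sum tendsto_mult[OF tendsto_const] laplace_moment_limit[OF \<rho> lim])
    have 2: "\<forall>\<^sub>F s in at_right 0. (\<Sum>i\<le>m. a i * S (\<lambda>x. x ^ i) s) = S (\<lambda>x. \<Sum>i\<le>m. a i * x ^ i) s"
    proof (rule eventually_mono[OF eventually_at_right_less[of 0]])
      fix s :: real assume s: "s > 0"
      have sx: "summable (\<lambda>n. b n * exp (- (s * real n)) * exp (- (s * real n)) ^ i)" for i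
        by (rule summ[where f = "\<lambda>x. x ^ i"]) (auto intro!: continuous_intros s)
      have "S (\<lambda>x. \<Sum>i\<le>m. a i * x ^ i) s
          = s powr \<rho> * (\<Sum>n. \<Sum>i\<le>m. a i * (b n * exp (- (s * n)) * exp (- (s * n)) ^ i))"
        unfolding S_def by (simp add: sum_distrib_left mult_ac)
      also have "(\<Sum>n. \<Sum>i\<le>m. a i * (b n * exp (- (s * n)) * exp (- (s * n)) ^ i))
          = (\<Sum>i\<le>m. \<Sum>n. a i * (b n * exp (- (s * n)) * exp (- (s * n)) ^ i))"
        by (intro suminf_sum summable_mult sx)
      also have "\<dots> = (\<Sum>i\<le>m. a i * (\<Sum>n. b n * exp (- (s * n)) * exp (- (s * n)) ^ i))"
        by (intro sum.cong refl suminf_mult sx)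
      finally show "(\<Sum>i\<le>m. a i * S (\<lambda>x. x ^ i) s) = S (\<lambda>x. \<Sum>i\<le>m. a i * x ^ i) s"
        unfolding S_def by (simp add: sum_distrib_left mult_ac)
    qed
    have 3: "(\<Sum>i\<le>m. a i * (K / Gamma \<rho> * G (\<lambda>x. x ^ i))) = K / Gamma \<rho> * G (\<lambda>x. \<Sum>i\<le>m. a i * x ^ i)"
    proof -
      have ix: "set_integrable lborel {0<..} (\<lambda>t. t powr (\<rho> - 1) * exp (- t) * exp (- t) ^ i)" for i
        by (rule intg[where f = "\<lambda>x. x ^ i"]) (auto intro!: continuous_intros)
      have "G (\<lambda>x. \<Sum>i\<le>m. a i * x ^ i)
          = (LINT t:{0<..}|lborel. \<Sum>i\<le>m. a i * (t powr (\<rho> - 1) * exp (- t) * exp (- t) ^ i))"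
        unfolding G_def by (simp add: sum_distrib_left mult_ac)
      also have "\<dots> = (\<Sum>i\<le>m. LINT t:{0<..}|lborel. a i * (t powr (\<rho> - 1) * exp (- t) * exp (- t) ^ i))"
        unfolding set_lebesgue_integral_def scaleR_sum_right
        by (intro Bochner_Integration.integral_sum set_integrable_mult_right[unfolded set_integrable_def]
            ix[unfolded set_integrable_def])
      also have "\<dots> = (\<Sum>i\<le>m. a i * G (\<lambda>x. x ^ i))"
        unfolding G_def by simp
      finally show ?thesis by (simp add: sum_distrib_left mult_ac)
    qed
    from Lim_transform_eventually[OF 1 2] show ?thesis unfolding 3 .
  qed
  have "\<exists>a m. \<forall>x\<in>{0..1}. \<bar>h x - (\<Sum>i\<le>m. a i * x ^ i)\<bar> \<le> 1 / Suc k" for k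
  proof -
    obtain p where "real_polynomial_function p" "\<And>x. x \<in> {0..1} \<Longrightarrow> \<bar>h x - p x\<bar> < 1 / real (Suc k)"
      using Stone_Weierstrass_real_polynomial_function[of "{0..1}" h "1 / Suc k"] h
      by (auto intro: continuous_on_subset)
    then show ?thesis
      unfolding real_polynomial_function_iff_sum by (metis less_imp_le)
  qed
  then obtain a m where am: "\<And>k x. x \<in> {0..1} \<Longrightarrow> \<bar>h x - (\<Sum>i\<le>m k. a k i * x ^ i)\<bar> \<le> 1 / Suc k"
    by metis
  define p where "p k x = (\<Sum>i\<le>m k. a k i * x ^ i)" for k and x :: real
  have p: "continuous_on UNIV (p k)" for k unfolding p_def by (intro continuous_intros)
  have hp: "\<bar>h x - p k x\<bar> \<le> 1 / Suc k" if "x \<in> {0..1}" for k x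
    using am[OF that] by (simp add: p_def)
  have inv0: "(\<lambda>k. 1 / real (Suc k)) \<longlonglongrightarrow> 0"
    by (rule lim_1_over_n[THEN LIMSEQ_Suc])
  \<comment> \<open>On \<open>A\<close> the normalised transform is at most K + 1, so polynomial
    approximation is uniform in \<open>s\<close> and the limits in \<open>k\<close> and
    \<open>s\<close> may be exchanged. By the assumed limit, \<open>A\<close> contains all small
    positive \<open>s\<close>.\<close>
  define A where "A = {s. s > 0 \<and> s powr \<rho> * (\<Sum>n. b n * exp (- (s * n))) \<le> K + 1}"
  have "((\<lambda>s. S h s) \<longlongrightarrow> K / Gamma \<rho> * G h) (at_right 0)"
  proof (rule swap_uniform_limit'[where F = sequentially and f = "\<lambda>k s. S (p k) s" and S = A])
    show "\<forall>\<^sub>F k in sequentially. ((\<lambda>s. S (p k) s) \<longlongrightarrow> K / Gamma \<rho> * G (p k)) (at_right 0)"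
      using poly unfolding p_def by auto
    have "(\<lambda>k. G (p k)) \<longlonglongrightarrow> G h"
    proof (rule Lim_null_comparison[where f = "\<lambda>k. G (p k) - G h" and g = "\<lambda>k. 1 / real (Suc k) * Gamma \<rho>", THEN LIM_zero_cancel])
      show "\<forall>\<^sub>F k in sequentially. norm (G (p k) - G h) \<le> 1 / real (Suc k) * Gamma \<rho>"
        using closeG[OF h p hp] by (auto simp: abs_minus_commute)
      show "(\<lambda>k. 1 / real (Suc k) * Gamma \<rho>) \<longlonglongrightarrow> 0"
        using tendsto_mult_left_zero[OF inv0] by simp
    qed
    then show "(\<lambda>k. K / Gamma \<rho> * G (p k)) \<longlonglongrightarrow> K / Gamma \<rho> * G h"
      by (intro tendsto_intros)
    show "uniform_limit A (\<lambda>k s. S (p k) s) (S h) sequentially"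
    proof (rule uniform_limitI)
      fix e :: real assume e: "e > 0"
      have "(\<lambda>k. 1 / real (Suc k) * (K + 1)) \<longlonglongrightarrow> 0"
        using tendsto_mult_left_zero[OF inv0] by simp
      then have "\<forall>\<^sub>F k in sequentially. 1 / real (Suc k) * (K + 1) < e"
        using e by (rule order_tendstoD)
      then show "\<forall>\<^sub>F k in sequentially. \<forall>s\<in>A. dist (S (p k) s) (S h s) < e"
      proof (rule eventually_mono, intro ballI)
        fix k s assume k: "1 / real (Suc k) * (K + 1) < e" and s: "s \<in> A"
        have "\<bar>S h s - S (p k) s\<bar> \<le> 1 / real (Suc k) * (s powr \<rho> * (\<Sum>n. b n * exp (- (s * n))))"
          using s by (intro close h p hp) (auto simp: A_def)
        also have "\<dots> \<le> 1 / real (Suc k) * (K + 1)"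
          using s by (intro mult_left_mono) (auto simp: A_def)
        finally show "dist (S (p k) s) (S h s) < e" using k by (simp add: dist_real_def abs_minus_commute)
      qed
    qed
    have "\<forall>\<^sub>F s in at_right 0. s powr \<rho> * (\<Sum>n. b n * exp (- (s * n))) < K + 1"
      using lim by (rule order_tendstoD) auto
    with eventually_at_right_less[of 0] show "\<forall>\<^sub>F s in at_right 0. s \<in> A"
      by eventually_elim (auto simp: A_def)
  qed auto
  then show ?thesis unfolding S_def G_def .
qed

lemma
  fixes \<rho> a :: real
  assumes "\<rho> > 0" "a \<ge> 0"
  shows set_integrable_powr_from_0: "set_integrable lborel {0<..a} (\<lambda>t. t powr (\<rho> - 1))"
    and set_integral_powr_from_0: "(LINT t:{0<..a}|lborel. t powr (\<rho> - 1)) = a powr \<rho> / \<rho>"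
proof -
  have hk: "((\<lambda>t. t powr (\<rho> - 1)) has_integral (a powr \<rho> / \<rho>)) {0..a}"
    using has_integral_powr_from_0[of "\<rho> - 1" a] assms by simp
  have "has_bochner_integral lborel (\<lambda>t. indicator {0..a} t * t powr (\<rho> - 1)) (a powr \<rho> / \<rho>)"
    using assms nn_integral_has_integral_lebesgue[OF _ hk]
    by (intro has_bochner_integral_nn_integral) auto
  moreover have "(\<lambda>t. indicator {0..a} t * t powr (\<rho> - 1)) = (\<lambda>t. indicator {0<..a} t *\<^sub>R t powr (\<rho> - 1))"
    using assms by (intro ext) (auto simp: indicator_def)
  ultimately show "set_integrable lborel {0<..a} (\<lambda>t. t powr (\<rho> - 1))"
    and "(LINT t:{0<..a}|lborel. t powr (\<rho> - 1)) = a powr \<rho> / \<rho>"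
    by (auto simp: set_integrable_def set_lebesgue_integral_def has_bochner_integral_iff)
qed

text \<open>A partial sum is the test function "indicator of t <= 1" applied to the measure with
  masses \<open>b k\<close> at the points k / n. The indicator is discontinuous, so only continuous
  majorants and minorants can be used; this is where \<open>b n \<ge> 0\<close> matters, since it
  makes the weighted sums monotone in the test function.\<close>

theorem karamata_tauberian:
  fixes b :: "nat \<Rightarrow> real" and \<rho> K :: real
  assumes \<rho>: "\<rho> > 0" and b: "\<And>n. b n \<ge> 0"
    and sm: "\<And>s. s > 0 \<Longrightarrow> summable (\<lambda>n. b n * exp (- (s * real n)))"
    and lim: "((\<lambda>s. s powr \<rho> * (\<Sum>n. b n * exp (- (s * n)))) \<longlongrightarrow> K) (at_right 0)"
  shows "(\<lambda>n. (\<Sum>k\<le>n. b k) / real n powr \<rho>) \<longlonglongrightarrow> K / Gamma (\<rho> + 1)"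
proof -
  have g: "Gamma \<rho> > 0" using \<rho> by (simp add: Gamma_real_pos)
  define D where "D = K / Gamma \<rho>"
  have "K \<ge> 0"
  proof (rule tendsto_lowerbound[OF lim])
    show "\<forall>\<^sub>F s in at_right 0. 0 \<le> s powr \<rho> * (\<Sum>n. b n * exp (- (s * n)))"
      by (rule eventually_mono[OF eventually_at_right_less[of 0]])
        (auto intro!: mult_nonneg_nonneg suminf_nonneg sm b)
  qed auto
  then have D: "D \<ge> 0" using g by (simp add: D_def)
  define a where "a n = (\<Sum>k\<le>n. b k) / real n powr \<rho>" for n
  \<comment> \<open>The ramp \<open>\<kappa>\<close> lies between the indicators of \<open>t \<le> 1\<close> and \<open>t \<le> 1 + \<delta>\<close>. Since both
    sides are homogeneous in the scale \<open>s\<close>, comparing at \<open>s = 1 / n\<close> and at \<open>s = (1 + \<delta>) / n\<close>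
    bounds the partial sums from above and from below.\<close>
  have bounds: "\<exists>I S. (S \<longlongrightarrow> D * I) (at_right 0) \<and> 1 / \<rho> \<le> I \<and> I \<le> (1 + \<delta>) powr \<rho> / \<rho> \<and>
      (\<forall>n>0. a n \<le> S (1 / real n) \<and> S ((1 + \<delta>) / real n) \<le> (1 + \<delta>) powr \<rho> * a n)"
    if \<delta>: "\<delta> > 0" for \<delta> :: real
  proof -
    define \<kappa> where "\<kappa> t = max 0 (min 1 ((1 + \<delta> - t) / \<delta>))" for t :: real
    \<comment> \<open>Chosen so that \<open>exp (- t) * h (exp (- t)) = \<kappa> t\<close>, i.e.
      \<open>\<kappa> (- ln x) / x\<close>. The cut-off by \<open>max\<close> removes the
      singularity at x = 0 and changes nothing, because \<open>\<kappa>\<close> already vanishes for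
      t at least 1 + \<delta>.\<close>
    define h where "h x = \<kappa> (- ln (max x (exp (- (1 + \<delta>))))) / max x (exp (- (1 + \<delta>)))" for x :: real
    define S where "S s = s powr \<rho> * (\<Sum>n. b n * \<kappa> (s * real n))" for s
    define I where "I = (LINT t:{0<..}|lborel. t powr (\<rho> - 1) * \<kappa> t)"
    have \<kappa>: "\<kappa> t = 1" if "t \<le> 1" for t
      using that \<delta> by (auto simp: \<kappa>_def field_simps)
    have \<kappa>0: "\<kappa> t = 0" if "t \<ge> 1 + \<delta>" for t
      using that \<delta> by (auto simp: \<kappa>_def field_simps min_def divide_le_0_iff)
    have \<kappa>b: "0 \<le> \<kappa> t" "\<kappa> t \<le> 1" for t by (auto simp: \<kappa>_def)
    have "max x (exp (- (1 + \<delta>))) > 0" for x by (simp add: less_max_iff_disj)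
    then have "max x (exp (- (1 + \<delta>))) \<noteq> 0" for x by (metis less_irrefl)
    then have h: "continuous_on UNIV h"
      unfolding h_def \<kappa>_def using \<delta> by (intro continuous_intros) auto
    have hk: "exp (- t) * h (exp (- t)) = \<kappa> t" for t
    proof (cases "t \<le> 1 + \<delta>")
      case True
      then have "max (exp (- t)) (exp (- (1 + \<delta>))) = exp (- t)" by (intro max_absorb1) auto
      then show ?thesis by (simp add: h_def)
    next
      case False
      then have "max (exp (- t)) (exp (- (1 + \<delta>))) = exp (- (1 + \<delta>))" by (intro max_absorb2) auto
      then show ?thesis using False \<kappa>0[of "1 + \<delta>"] \<kappa>0[of t] by (simp add: h_def add.commute)
    qed
    have "((\<lambda>s. s powr \<rho> * (\<Sum>n. b n * (exp (- (s * n)) * h (exp (- (s * n)))))) \<longlongrightarrow>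
      D * (LINT t:{0<..}|lborel. t powr (\<rho> - 1) * (exp (- t) * h (exp (- t))))) (at_right 0)"
      using laplace_continuous_limit[OF \<rho> b sm lim h] by (simp add: D_def mult.assoc)
    then have "(S \<longlongrightarrow> D * I) (at_right 0)"
      unfolding hk S_def[symmetric] I_def[symmetric] .
    moreover have ind: "(LINT t:{0<..}|lborel. indicator {..c} t * t powr (\<rho> - 1)) = c powr \<rho> / \<rho>"
      "set_integrable lborel {0<..} (\<lambda>t. indicator {..c} t * t powr (\<rho> - 1))"
      if "c \<ge> 0" for c
    proof -
      have "(\<lambda>t. indicat_real {0<..} t *\<^sub>R (indicator {..c} t * t powr (\<rho> - 1)))
        = (\<lambda>t. indicator {0<..c} t *\<^sub>R t powr (\<rho> - 1))"
        by (auto simp: indicator_def)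
      then show "(LINT t:{0<..}|lborel. indicator {..c} t * t powr (\<rho> - 1)) = c powr \<rho> / \<rho>"
        "set_integrable lborel {0<..} (\<lambda>t. indicator {..c} t * t powr (\<rho> - 1))"
        using set_integral_powr_from_0[OF \<rho> that] set_integrable_powr_from_0[OF \<rho> that]
        by (simp_all add: set_integrable_def set_lebesgue_integral_def)
    qed
    have le: "t powr (\<rho> - 1) * \<kappa> t \<le> indicator {..1+\<delta>} t * t powr (\<rho> - 1)"
      and ge: "indicator {..1} t * t powr (\<rho> - 1) \<le> t powr (\<rho> - 1) * \<kappa> t" for t :: real
      using \<kappa>[of t] \<kappa>0[of t] \<kappa>b[of t] by (auto simp: indicator_def intro: mult_left_le)
    have ik: "set_integrable lborel {0<..} (\<lambda>t. t powr (\<rho> - 1) * \<kappa> t)"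
    proof (rule set_integrable_bound[OF ind(2)[of "1 + \<delta>"]])
      have "norm (t powr (\<rho> - 1) * \<kappa> t) \<le> norm (indicator {..1 + \<delta>} t * t powr (\<rho> - 1))" for t
        using le[of t] \<kappa>b[of t] by simp
      then show "AE t in lborel. t \<in> {0<..} \<longrightarrow> norm (t powr (\<rho> - 1) * \<kappa> t)
          \<le> norm (indicator {..1 + \<delta>} t * t powr (\<rho> - 1))" by simp
      show "set_borel_measurable lborel {0<..} (\<lambda>t. t powr (\<rho> - 1) * \<kappa> t)"
        unfolding set_borel_measurable_def \<kappa>_def by measurable
    qed (use \<delta> in auto)
    have "I \<le> (LINT t:{0<..}|lborel. indicator {..1+\<delta>} t * t powr (\<rho> - 1))"
      unfolding I_def using ik ind(2)[of "1 + \<delta>"] \<delta> le by (intro set_integral_mono) auto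
    then have "I \<le> (1 + \<delta>) powr \<rho> / \<rho>" using ind(1)[of "1 + \<delta>"] \<delta> by simp
    moreover have "(LINT t:{0<..}|lborel. indicator {..1} t * t powr (\<rho> - 1)) \<le> I"
      unfolding I_def using ik ind(2)[of 1] ge by (intro set_integral_mono) auto
    then have "1 / \<rho> \<le> I" using ind(1)[of 1] by simp
    moreover have "a n \<le> S (1 / real n) \<and> S ((1 + \<delta>) / real n) \<le> (1 + \<delta>) powr \<rho> * a n"
      if n: "n > 0" for n
    proof
      have sk: "summable (\<lambda>k. b k * \<kappa> (s * real k))" if "s > 0" for s
      proof (rule summable_finite[of "{..nat \<lceil>(1 + \<delta>) / s\<rceil>}"])
        fix k assume "k \<notin> {..nat \<lceil>(1 + \<delta>) / s\<rceil>}"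
        then have "(1 + \<delta>) / s \<le> real k" by (auto simp: not_le) linarith
        then have "1 + \<delta> \<le> s * k" using that by (simp add: field_simps)
        then show "b k * \<kappa> (s * k) = 0" by (simp add: \<kappa>0)
      qed auto
      have "(\<Sum>k\<le>n. b k) = (\<Sum>k\<le>n. b k * \<kappa> (1 / real n * real k))"
        using n by (intro sum.cong refl) (simp add: \<kappa>)
      also have "\<dots> \<le> (\<Sum>k. b k * \<kappa> (1 / real n * real k))"
        using n b \<kappa>b by (intro sum_le_suminf sk) auto
      finally have "(\<Sum>k\<le>n. b k) \<le> (\<Sum>k. b k * \<kappa> (1 / real n * real k))" .
      then show "a n \<le> S (1 / real n)"
        unfolding a_def S_def using n by (simp add: powr_divide divide_right_mono)
      have "(\<Sum>k. b k * \<kappa> ((1 + \<delta>) / real n * real k)) = (\<Sum>k\<le>n. b k * \<kappa> ((1 + \<delta>) / real n * real k))"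
      proof (rule suminf_finite)
        fix k assume "k \<notin> {..n}"
        then have "(1 + \<delta>) * real n \<le> (1 + \<delta>) * real k" using \<delta> by (intro mult_left_mono) auto
        then have "1 + \<delta> \<le> (1 + \<delta>) / real n * real k" using n by (simp add: field_simps)
        then show "b k * \<kappa> ((1 + \<delta>) / real n * real k) = 0" by (simp add: \<kappa>0)
      qed auto
      also have "\<dots> \<le> (\<Sum>k\<le>n. b k)" using b \<kappa>b by (intro sum_mono mult_left_le) auto
      finally show "S ((1 + \<delta>) / real n) \<le> (1 + \<delta>) powr \<rho> * a n"
        unfolding a_def S_def using n \<delta> by (simp add: powr_divide divide_right_mono mult_left_mono)
    qed
    ultimately show ?thesis by blast
  qed
  have scale: "filterlim (\<lambda>n. C / real n) (at_right 0) sequentially" if "C > 0" for C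
    unfolding filterlim_at
    using that lim_const_over_n[of C] by (auto intro: eventually_mono[OF eventually_gt_at_top[of 0]])
  \<comment> \<open>The two bounds on \<open>a n\<close> differ from D / \<rho> only by a factor (1
    + \<delta>)^\<rho>. Any given margin between \<open>y\<close> and D / \<rho> fixes a \<delta>
    small enough to absorb it, before n tends to infinity.\<close>
  have ev: "\<forall>\<^sub>F n in sequentially. a n < y" if y: "D / \<rho> < y" for y
  proof -
    have "((\<lambda>\<delta>. D * ((1 + \<delta>) powr \<rho> / \<rho>)) \<longlongrightarrow> D * ((1 + 0) powr \<rho> / \<rho>)) (at_right 0)"
      using \<rho> by (intro tendsto_intros) auto
    then have "\<forall>\<^sub>F \<delta> in at_right 0. D * ((1 + \<delta>) powr \<rho> / \<rho>) < y"
      using y by (intro order_tendstoD) auto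
    with eventually_at_right_less[of 0] have "\<forall>\<^sub>F \<delta> in at_right 0. \<delta> > 0 \<and> D * ((1 + \<delta>) powr \<rho> / \<rho>) < y"
      by eventually_elim auto
    then obtain \<delta> where \<delta>: "\<delta> > 0" "D * ((1 + \<delta>) powr \<rho> / \<rho>) < y"
      using eventually_happens[of _ "at_right (0::real)"] by auto
    obtain I S where S: "(S \<longlongrightarrow> D * I) (at_right 0)" "I \<le> (1 + \<delta>) powr \<rho> / \<rho>"
        "\<And>n. n > 0 \<Longrightarrow> a n \<le> S (1 / real n)"
      using bounds[OF \<delta>(1)] by auto
    have "D * I < y" using \<delta>(2) mult_left_mono[OF S(2) D] by linarith
    then have "\<forall>\<^sub>F n in sequentially. S (1 / real n) < y"
      using filterlim_compose[OF S(1) scale[of 1]] by (intro order_tendstoD) auto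
    with eventually_gt_at_top[of 0] show ?thesis
      by eventually_elim (rule le_less_trans[OF S(3)])
  qed
  have ev': "\<forall>\<^sub>F n in sequentially. y < a n" if y: "y < D / \<rho>" for y
  proof -
    have "((\<lambda>\<delta>. (1 + \<delta>) powr \<rho> * y) \<longlongrightarrow> (1 + 0) powr \<rho> * y) (at_right 0)"
      by (intro tendsto_intros) auto
    then have "\<forall>\<^sub>F \<delta> in at_right 0. (1 + \<delta>) powr \<rho> * y < D / \<rho>"
      using y by (intro order_tendstoD) auto
    with eventually_at_right_less[of 0] have "\<forall>\<^sub>F \<delta> in at_right 0. \<delta> > 0 \<and> (1 + \<delta>) powr \<rho> * y < D / \<rho>"
      by eventually_elim auto
    then obtain \<delta> where \<delta>: "\<delta> > 0" "(1 + \<delta>) powr \<rho> * y < D / \<rho>"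
      using eventually_happens[of _ "at_right (0::real)"] by auto
    obtain I S where S: "(S \<longlongrightarrow> D * I) (at_right 0)" "1 / \<rho> \<le> I"
        "\<And>n. n > 0 \<Longrightarrow> S ((1 + \<delta>) / real n) \<le> (1 + \<delta>) powr \<rho> * a n"
      using bounds[OF \<delta>(1)] by auto
    have "(1 + \<delta>) powr \<rho> * y < D * I" using \<delta>(2) mult_left_mono[OF S(2) D] by simp
    then have "\<forall>\<^sub>F n in sequentially. (1 + \<delta>) powr \<rho> * y < S ((1 + \<delta>) / real n)"
      using \<delta> filterlim_compose[OF S(1) scale[of "1 + \<delta>"]] by (intro order_tendstoD) auto
    with eventually_gt_at_top[of 0] show ?thesis
    proof eventually_elim
      case (elim n)
      then have "(1 + \<delta>) powr \<rho> * y < (1 + \<delta>) powr \<rho> * a n" using S(3)[of n] by linarith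
      then show ?case using \<delta> by simp
    qed
  qed
  have "a \<longlonglongrightarrow> D / \<rho>" using ev ev' by (intro order_tendstoI) auto
  moreover have "D / \<rho> = K / Gamma (\<rho> + 1)"
    using \<rho> g by (subst Gamma_plus1) (auto simp: D_def mult.commute elim!: nonpos_Ints_cases)
  ultimately show ?thesis unfolding a_def by simp
qed

section \<open>Asymptotics of the hitting time transforms\<close>

text \<open>The factor for \<open>j\<close> is forced by the balance at a fresh maximum j. Going up
  with weight 1 / (1 + c) and down with weight c / (1 + c) must multiply the eigenfunction by cosh
  u, so the ratio of its values at consecutive maxima is (1 + c) * cosh u - c * cosh (u * (j - 1)) /
  cosh (u * j). For j = 0 the factor is cosh u, which matches the forced step away from 0.\<close>

definition hitting_denom :: "real \<Rightarrow> real \<Rightarrow> nat \<Rightarrow> real" where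
  "hitting_denom c u k = (\<Prod>j<k. cosh u + c * tanh (u * real j) * sinh u)"

lemma hitting_denom_Suc:
  "hitting_denom c u (Suc k) = hitting_denom c u k * (cosh u + c * tanh (u * real k) * sinh u)"
  by (simp add: hitting_denom_def)

lemma hitting_denom_pos: "c > 0 \<Longrightarrow> u \<ge> 0 \<Longrightarrow> hitting_denom c u k > 0"
  unfolding hitting_denom_def by (intro prod_pos ballI add_pos_nonneg) auto

text \<open>Both logarithms equal c * v up to second order: each lies below c * v, by at most (c *
  v)^2 and c * v^2 respectively, since x - x^2 <= ln (1 + x) <= x for nonnegative x.\<close>

lemma ln_one_plus_mult_diff_le:
  fixes c v :: real
  assumes "c > 0" "v \<ge> 0"
  shows "\<bar>ln (1 + c * v) - c * ln (1 + v)\<bar> \<le> (c + c\<^sup>2) * v\<^sup>2"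
proof -
  have lower: "x - x\<^sup>2 \<le> ln (1 + x)" if "x \<ge> 0" for x :: real
  proof (cases "x \<le> 1")
    case True
    then show ?thesis using that ln_one_plus_pos_lower_bound by blast
  next
    case False
    then have "x * 1 \<le> x * x" by (intro mult_left_mono) auto
    moreover have "0 \<le> ln (1 + x)" using that by simp
    ultimately show ?thesis by (simp add: power2_eq_square)
  qed
  have "ln (1 + c * v) \<le> c * v" "c * v - (c * v)\<^sup>2 \<le> ln (1 + c * v)"
    using assms by (auto intro!: ln_add_one_self_le_self lower)
  moreover have "c * ln (1 + v) \<le> c * v" "c * (v - v\<^sup>2) \<le> c * ln (1 + v)"
    using assms by (auto intro!: mult_left_mono ln_add_one_self_le_self lower)
  moreover have "0 \<le> c * v\<^sup>2" "0 \<le> c\<^sup>2 * v\<^sup>2" using assms by auto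
  ultimately show ?thesis
    by (auto simp: abs_le_iff algebra_simps power_mult_distrib)
qed

text \<open>For \<open>c = 1\<close> the factors are \<open>cosh (u * (j + 1)) / cosh (u * j)\<close> and the product telescopes;
  for general \<open>c\<close> each factor is compared with the \<open>c\<close>-th power of this one.\<close>

lemma ln_hitting_denom:
  assumes c: "c > 0" and u: "u \<ge> 0"
  shows "\<bar>ln (hitting_denom c u k) - c * ln (cosh (u * real k))\<bar> \<le> (1 + c)\<^sup>2 * real k * (sinh u)\<^sup>2"
proof (induction k)
  case 0
  show ?case by (simp add: hitting_denom_def)
next
  case (Suc k)
  \<comment> \<open>The new factor is cosh u * (1 + c * w), and for c = 1 it is cosh u * (1 + w).
    The discrepancy per level is thus (1 - c) * ln (cosh u) plus the difference of logarithms
    estimated above. As w <= sinh u, these cost (1 + c) and c + c^2 times sinh^2 u, which add up to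
    (1 + c)^2.\<close>
  define w where "w = tanh (u * real k) * tanh u"
  have w0: "w \<ge> 0" using u by (simp add: w_def)
  have "tanh u \<le> sinh u"
    using u mult_right_mono[OF cosh_real_ge_1[of u], of "sinh u"] by (simp add: tanh_def field_simps)
  then have "w \<le> 1 * sinh u"
    unfolding w_def using u tanh_real_lt_1[of "u * real k"] by (intro mult_mono) auto
  then have w: "w\<^sup>2 \<le> (sinh u)\<^sup>2" using w0 by (intro power_mono) auto
  have lnc0: "0 \<le> ln (cosh u)" using cosh_real_ge_1[of u] by simp
  have "2 * ln (cosh u) = ln (1 + (sinh u)\<^sup>2)"
    using ln_realpow[of "cosh u" 2] by (simp add: cosh_square_eq add.commute)
  also have "\<dots> \<le> (sinh u)\<^sup>2" by (rule ln_add_one_self_le_self) simp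
  finally have lnc: "ln (cosh u) \<le> (sinh u)\<^sup>2" using lnc0 by linarith
  have f1: "cosh u + c * tanh (u * real k) * sinh u = cosh u * (1 + c * w)"
    by (simp add: w_def tanh_def field_simps)
  have f2: "cosh (u * real (Suc k)) = cosh (u * real k) * (cosh u * (1 + w))"
    by (simp add: w_def tanh_def field_simps cosh_add)
  have pos: "1 + c * w > 0" "1 + w > 0" using w0 c by (auto intro: add_pos_nonneg)
  have "ln (hitting_denom c u (Suc k)) = ln (hitting_denom c u k) + (ln (cosh u) + ln (1 + c * w))"
    unfolding hitting_denom_Suc f1 using pos hitting_denom_pos[OF c u, of k]
    by (subst ln_mult, simp_all add: ln_mult)
  moreover have "ln (cosh (u * real (Suc k))) = ln (cosh (u * real k)) + (ln (cosh u) + ln (1 + w))"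
    unfolding f2 using pos by (simp add: ln_mult)
  ultimately have "ln (hitting_denom c u (Suc k)) - c * ln (cosh (u * real (Suc k)))
      = (ln (hitting_denom c u k) - c * ln (cosh (u * real k)))
        + ((1 - c) * ln (cosh u) + (ln (1 + c * w) - c * ln (1 + w)))"
    by (simp add: algebra_simps)
  also have "\<bar>\<dots>\<bar> \<le> (1 + c)\<^sup>2 * real k * (sinh u)\<^sup>2 + ((1 + c) * (sinh u)\<^sup>2 + (c + c\<^sup>2) * (sinh u)\<^sup>2)"
  proof -
    have "\<bar>(1 - c) * ln (cosh u)\<bar> \<le> (1 + c) * (sinh u)\<^sup>2"
      unfolding abs_mult using c lnc lnc0 by (intro mult_mono) auto
    moreover have "\<bar>ln (1 + c * w) - c * ln (1 + w)\<bar> \<le> (c + c\<^sup>2) * (sinh u)\<^sup>2"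
      using ln_one_plus_mult_diff_le[OF c w0] mult_left_mono[OF w, of "c + c\<^sup>2"] c by simp
    ultimately show ?thesis using Suc.IH by linarith
  qed
  also have "\<dots> = (1 + c)\<^sup>2 * real (Suc k) * (sinh u)\<^sup>2"
    by (simp add: algebra_simps power2_eq_square)
  finally show ?case .
qed

text \<open>This supplies a dominating function independent of \<open>u\<close>. The bound cosh y >=
  exp y / 2 gives decay at rate c in y = u * k, while the logarithmic error grows linearly in
  \<open>k\<close>; the smallness assumption lets that error consume at most half of the rate,
  leaving c / 2.\<close>

lemma inverse_hitting_denom_le:
  assumes c: "c > 0" and u: "u \<ge> 0" and small: "(1 + c)\<^sup>2 * (sinh u)\<^sup>2 \<le> c / 2 * u"
  shows "1 / hitting_denom c u k \<le> 2 powr c * exp (- (c / 2 * (u * real k)))"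
proof -
  let ?y = "u * real k"
  have "exp ?y / 2 \<le> cosh ?y" by (simp add: cosh_field_def)
  then have "ln (exp ?y / 2) \<le> ln (cosh ?y)" by (intro ln_mono) auto
  then have "?y - ln 2 \<le> ln (cosh ?y)" by (simp add: ln_div)
  then have "c * (?y - ln 2) \<le> c * ln (cosh ?y)" using c by (intro mult_left_mono) auto
  moreover have "(1 + c)\<^sup>2 * (sinh u)\<^sup>2 * real k \<le> c / 2 * u * real k"
    using small by (intro mult_right_mono) auto
  ultimately have "c / 2 * ?y - c * ln 2 \<le> ln (hitting_denom c u k)"
    using ln_hitting_denom[OF c u, of k] by (simp add: algebra_simps abs_le_iff)
  then have "exp (- ln (hitting_denom c u k)) \<le> exp (c * ln 2 + - (c / 2 * ?y))" by simp
  then show ?thesis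
    unfolding exp_add using hitting_denom_pos[OF c u, of k]
    by (simp add: exp_minus powr_def inverse_eq_divide)
qed

section \<open>Sums over levels as integrals, and their scaling limit\<close>

lemma set_integral_power_Ioc:
  fixes a b :: real
  assumes "0 \<le> a" "a \<le> b" "l \<ge> 1"
  shows "(LINT x:{a<..b}|lborel. real l * x ^ (l - 1)) = b ^ l - a ^ l"
proof -
  have "(LINT x:{a<..b}|lborel. real l * x ^ (l - 1)) = (LINT x:{a..b}|lborel. real l * x ^ (l - 1))"
    using AE_lborel_singleton[of a]
    by (intro set_integral_cong_set) (auto simp: set_borel_measurable_def)
  also have "\<dots> = (\<integral>x. (real l * x ^ (l - 1)) * indicator {a..b} x \<partial>lborel)"
    unfolding set_lebesgue_integral_def by (intro Bochner_Integration.integral_cong) auto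
  also have "\<dots> = b ^ l - a ^ l"
    using assms by (intro integral_FTC_Icc_nonneg) (auto intro!: derivative_eq_intros)
  finally show ?thesis .
qed

text \<open>The ceiling of x / u is k + 1 exactly on the half-open interval from u * k to u * (k +
  1), over which l * x^(l-1) integrates to the difference of l-th powers. The level sum is therefore
  an integral with no discretisation error, so that dominated convergence can replace a Riemann sum
  argument.\<close>

lemma set_integral_ceiling:
  fixes \<psi> :: "nat \<Rightarrow> real" and u :: real
  assumes u: "u > 0" and l: "l \<ge> 1"
    and int: "set_integrable lborel {0<..} (\<lambda>x. real l * x ^ (l - 1) * \<psi> (nat \<lceil>x / u\<rceil>))"
  shows "(LINT x:{0<..}|lborel. real l * x ^ (l - 1) * \<psi> (nat \<lceil>x / u\<rceil>))
    = (\<Sum>k. ((u * real (Suc k)) ^ l - (u * real k) ^ l) * \<psi> (Suc k))"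
proof -
  define A where "A k = {u * real k <.. u * real (Suc k)}" for k
  have A: "x \<in> A k \<longleftrightarrow> x > 0 \<and> nat \<lceil>x / u\<rceil> = Suc k" for x k
  proof -
    have "x \<in> A k \<longleftrightarrow> real k < x / u \<and> x / u \<le> real (Suc k)"
      using u by (auto simp: A_def field_simps)
    also have "\<dots> \<longleftrightarrow> \<lceil>x / u\<rceil> = int (Suc k)"
      by (auto simp: ceiling_eq_iff)
    also have "\<dots> \<longleftrightarrow> x > 0 \<and> nat \<lceil>x / u\<rceil> = Suc k"
    proof
      assume *: "\<lceil>x / u\<rceil> = int (Suc k)"
      then have "x / u > 0" by (simp add: ceiling_eq_iff)
      then show "x > 0 \<and> nat \<lceil>x / u\<rceil> = Suc k" using u * by (simp add: zero_less_divide_iff)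
    qed auto
    finally show ?thesis .
  qed
  have meas: "A k \<in> sets borel" for k by (simp add: A_def)
  have un: "{0<..} = (\<Union>k. A k)"
  proof (intro set_eqI iffI)
    fix x :: real assume x: "x \<in> {0<..}"
    then have "nat \<lceil>x / u\<rceil> > 0" using u by simp
    then show "x \<in> (\<Union>k. A k)" using x A[of x "nat \<lceil>x / u\<rceil> - 1"] by auto
  next
    fix x assume "x \<in> (\<Union>k. A k)"
    then show "x \<in> {0<..}" by (auto simp: A)
  qed
  have "(LINT x:(\<Union>k. A k)|lborel. real l * x ^ (l - 1) * \<psi> (nat \<lceil>x / u\<rceil>))
      = (\<Sum>k. LINT x:A k|lborel. real l * x ^ (l - 1) * \<psi> (nat \<lceil>x / u\<rceil>))"
    using int unfolding un
    by (intro lebesgue_integral_countable_add) (auto simp: A meas)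
  also have "\<dots> = (\<Sum>k. ((u * real (Suc k)) ^ l - (u * real k) ^ l) * \<psi> (Suc k))"
  proof (rule suminf_cong)
    fix k
    have "(LINT x:A k|lborel. real l * x ^ (l - 1) * \<psi> (nat \<lceil>x / u\<rceil>))
        = (LINT x:A k|lborel. real l * x ^ (l - 1) * \<psi> (Suc k))"
      by (intro set_lebesgue_integral_cong) (auto simp: A meas)
    also have "\<dots> = ((u * real (Suc k)) ^ l - (u * real k) ^ l) * \<psi> (Suc k)"
      unfolding A_def using u l set_integral_power_Ioc[of "u * real k" "u * real (Suc k)" l]
      by (simp add: mult_left_mono del: of_nat_Suc)
    finally show "(LINT x:A k|lborel. real l * x ^ (l - 1) * \<psi> (nat \<lceil>x / u\<rceil>))
      = ((u * real (Suc k)) ^ l - (u * real k) ^ l) * \<psi> (Suc k)" .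
  qed
  finally show ?thesis unfolding un .
qed

text \<open>The rounded point \<open>y u\<close> is within u of x, and the logarithmic error (1 +
  c)^2 * k * sinh^2 u equals (1 + c)^2 * y * (sinh^2 u / u), which vanishes in the limit because
  sinh^2 u is of order u^2.\<close>

lemma tendsto_hitting_denom_ceiling:
  assumes c: "c > 0" and x: "x > 0"
  shows "((\<lambda>u. 1 / hitting_denom c u (nat \<lceil>x / u\<rceil>)) \<longlongrightarrow> cosh x powr (- c)) (at_right 0)"
proof -
  define y where "y u = u * real (nat \<lceil>x / u\<rceil>)" for u
  have y: "(y \<longlongrightarrow> x) (at_right 0)"
  proof (rule tendsto_sandwich)
    show "\<forall>\<^sub>F u in at_right 0. x \<le> y u" "\<forall>\<^sub>F u in at_right 0. y u \<le> x + u"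
    proof (rule_tac [!] eventually_mono[OF eventually_at_right_less[of 0]])
      fix u :: real assume u: "u > 0"
      have "x / u \<le> real (nat \<lceil>x / u\<rceil>)" "real (nat \<lceil>x / u\<rceil>) \<le> x / u + 1"
        using u x by (auto simp: of_nat_nat)
      then have "u * (x / u) \<le> y u" "y u \<le> u * (x / u + 1)"
        unfolding y_def using u by (auto intro!: mult_left_mono simp del: times_divide_eq_right)
      moreover have "u * (x / u) = x" "u * (x / u + 1) = x + u" using u by (auto simp: distrib_left)
      ultimately show "x \<le> y u" "y u \<le> x + u" by auto
    qed
    show "((\<lambda>u. x + u) \<longlongrightarrow> x) (at_right 0)" by (auto intro!: tendsto_eq_intros)
  qed auto
  have "((\<lambda>u. ln (hitting_denom c u (nat \<lceil>x / u\<rceil>)) - c * ln (cosh (y u))) \<longlongrightarrow> 0) (at_right 0)"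
  proof (rule Lim_null_comparison)
    have "((\<lambda>u::real. (sinh u)\<^sup>2 / u) \<longlongrightarrow> 0) (at_right 0)" by real_asymp
    from tendsto_mult[OF tendsto_mult[OF tendsto_const[of "(1 + c)\<^sup>2"] y] this]
    show "((\<lambda>u. (1 + c)\<^sup>2 * y u * ((sinh u)\<^sup>2 / u)) \<longlongrightarrow> 0) (at_right 0)" by simp
    show "\<forall>\<^sub>F u in at_right 0. norm (ln (hitting_denom c u (nat \<lceil>x / u\<rceil>)) - c * ln (cosh (y u)))
        \<le> (1 + c)\<^sup>2 * y u * ((sinh u)\<^sup>2 / u)"
    proof (rule eventually_mono[OF eventually_at_right_less[of 0]])
      fix u :: real assume u: "u > 0"
      have "(1 + c)\<^sup>2 * y u * ((sinh u)\<^sup>2 / u) = (1 + c)\<^sup>2 * real (nat \<lceil>x / u\<rceil>) * (sinh u)\<^sup>2"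
        using u by (simp add: y_def)
      then show "norm (ln (hitting_denom c u (nat \<lceil>x / u\<rceil>)) - c * ln (cosh (y u)))
        \<le> (1 + c)\<^sup>2 * y u * ((sinh u)\<^sup>2 / u)"
        using ln_hitting_denom[OF c, of u "nat \<lceil>x / u\<rceil>"] u unfolding y_def by simp
    qed
  qed
  moreover have "((\<lambda>u. c * ln (cosh (y u))) \<longlongrightarrow> c * ln (cosh x)) (at_right 0)"
    using y by (intro tendsto_intros) auto
  ultimately have "((\<lambda>u. ln (hitting_denom c u (nat \<lceil>x / u\<rceil>))) \<longlongrightarrow> c * ln (cosh x)) (at_right 0)"
    using tendsto_add by fastforce
  then have "((\<lambda>u. exp (- ln (hitting_denom c u (nat \<lceil>x / u\<rceil>)))) \<longlongrightarrow> exp (- (c * ln (cosh x)))) (at_right 0)"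
    by (intro tendsto_intros)
  moreover have "\<forall>\<^sub>F u in at_right 0. exp (- ln (hitting_denom c u (nat \<lceil>x / u\<rceil>)))
      = 1 / hitting_denom c u (nat \<lceil>x / u\<rceil>)"
    by (rule eventually_mono[OF eventually_at_right_less[of 0]])
      (use hitting_denom_pos[OF c] in \<open>simp add: exp_minus inverse_eq_divide\<close>)
  ultimately show ?thesis
    by (auto simp: powr_def intro: Lim_transform_eventually)
qed

lemma set_integrable_power_exp:
  fixes a :: real
  assumes "a > 0" "l \<ge> 1"
  shows "set_integrable lborel {0<..} (\<lambda>x. x ^ (l - 1) * exp (- (a * x)))"
proof -
  have "set_integrable lborel {0<..} (\<lambda>x. x powr (real l - 1) * exp (- (a * x)))"
    using assms by (intro set_integrable_powr_exp) auto
  moreover have "x powr (real l - 1) = x ^ (l - 1)" if "x > 0" for x :: real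
    using assms that by (simp add: powr_realpow[symmetric] of_nat_diff)
  ultimately show ?thesis
    by (subst (asm) set_integrable_cong[OF refl refl, where f' = "\<lambda>x. x ^ (l - 1) * exp (- (a * x))"]) auto
qed

lemma tendsto_hitting_sum:
  assumes c: "c > 0" and l: "l \<ge> 1"
  shows "((\<lambda>u. \<Sum>k. ((u * real (Suc k)) ^ l - (u * real k) ^ l) / hitting_denom c u (Suc k)) \<longlongrightarrow>
      real l * (LINT x:{0<..}|lborel. x ^ (l - 1) * cosh x powr (- c))) (at_right 0)"
proof -
  define F where "F u x = real l * x ^ (l - 1) * (1 / hitting_denom c u (nat \<lceil>x / u\<rceil>))" for u x :: real
  define w where "w x = indicator {0<..} x *\<^sub>R (real l * 2 powr c * (x ^ (l - 1) * exp (- (c / 2 * x))))" for x :: real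
  have w: "integrable lborel w"
    unfolding w_def set_integrable_def[symmetric]
    using c l by (intro set_integrable_mult_right set_integrable_power_exp) auto
  have "((\<lambda>u::real. (1 + c)\<^sup>2 * ((sinh u)\<^sup>2 / u)) \<longlongrightarrow> (1 + c)\<^sup>2 * 0) (at_right 0)"
    by (intro tendsto_mult tendsto_const) real_asymp
  then have "\<forall>\<^sub>F u in at_right 0. (1 + c)\<^sup>2 * ((sinh u)\<^sup>2 / u) < c / 2"
    using c by (intro order_tendstoD) auto
  with eventually_at_right_less[of 0]
  have small: "\<forall>\<^sub>F u in at_right 0. u > 0 \<and> (1 + c)\<^sup>2 * (sinh u)\<^sup>2 \<le> c / 2 * u"
    by eventually_elim (auto simp: field_simps)
  have bound: "norm (indicator {0<..} x *\<^sub>R F u x) \<le> w x"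
    if u: "u > 0" "(1 + c)\<^sup>2 * (sinh u)\<^sup>2 \<le> c / 2 * u" for u x
  proof (cases "x > 0")
    case True
    have "x / u \<le> real (nat \<lceil>x / u\<rceil>)" using u True by (simp add: of_nat_nat)
    then have "x \<le> u * real (nat \<lceil>x / u\<rceil>)" using u by (simp add: field_simps)
    then have "2 powr c * exp (- (c / 2 * (u * real (nat \<lceil>x / u\<rceil>)))) \<le> 2 powr c * exp (- (c / 2 * x))"
      using c by simp
    with inverse_hitting_denom_le[OF c _ u(2), of "nat \<lceil>x / u\<rceil>"] u(1)
    have "1 / hitting_denom c u (nat \<lceil>x / u\<rceil>) \<le> 2 powr c * exp (- (c / 2 * x))" by linarith
    then have "real l * x ^ (l - 1) * (1 / hitting_denom c u (nat \<lceil>x / u\<rceil>))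
        \<le> real l * x ^ (l - 1) * (2 powr c * exp (- (c / 2 * x)))"
      using True by (intro mult_left_mono) auto
    moreover have "F u x \<ge> 0" unfolding F_def
      using True u hitting_denom_pos[OF c, of u "nat \<lceil>x / u\<rceil>"] by auto
    ultimately show ?thesis using True by (simp add: F_def w_def mult_ac)
  qed (simp add: w_def)
  have meas: "(\<lambda>x. indicator {0<..} x *\<^sub>R F u x) \<in> borel_measurable lborel" for u
    unfolding F_def by measurable
  \<comment> \<open>With t = 1 / u the limit from the right at 0 becomes a limit at infinity, the
    form in which dominated convergence along a real parameter is applied.\<close>
  have "((\<lambda>t. \<integral>x. indicator {0<..} x *\<^sub>R F (inverse t) x \<partial>lborel) \<longlongrightarrow>
      (\<integral>x. indicator {0<..} x *\<^sub>R (real l * x ^ (l - 1) * cosh x powr (- c)) \<partial>lborel)) at_top"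
  proof (rule integral_dominated_convergence_at_top[where w = w])
    have "\<forall>\<^sub>F t in at_top. inverse t > 0 \<and> (1 + c)\<^sup>2 * (sinh (inverse t))\<^sup>2 \<le> c / 2 * inverse t"
      using small by (simp add: eventually_at_right_to_top)
    then show "\<forall>\<^sub>F t in at_top. AE x in lborel. norm (indicator {0<..} x *\<^sub>R F (inverse t) x) \<le> w x"
      by (rule eventually_mono) (intro AE_I2 bound, auto)
    have "((\<lambda>t. indicator {0<..} x *\<^sub>R F (inverse t) x) \<longlongrightarrow>
        indicator {0<..} x *\<^sub>R (real l * x ^ (l - 1) * cosh x powr (- c))) at_top" for x
    proof (cases "x > 0")
      case True
      from tendsto_hitting_denom_ceiling[OF c this]
      show ?thesis unfolding F_def filterlim_at_right_to_top
        by (intro tendsto_intros)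
    qed simp
    then show "AE x in lborel. ((\<lambda>t. indicator {0<..} x *\<^sub>R F (inverse t) x) \<longlongrightarrow>
        indicator {0<..} x *\<^sub>R (real l * x ^ (l - 1) * cosh x powr (- c))) at_top" by simp
    show "(\<lambda>x. indicator {0<..} x *\<^sub>R (real l * x ^ (l - 1) * cosh x powr (- c))) \<in> borel_measurable lborel"
    proof -
      have [measurable]: "(\<lambda>x::real. cosh x) \<in> borel_measurable borel"
        by (intro borel_measurable_continuous_onI continuous_intros)
      show ?thesis by measurable
    qed
  qed (use w meas in auto)
  then have "((\<lambda>u. LINT x:{0<..}|lborel. F u x) \<longlongrightarrow>
      (LINT x:{0<..}|lborel. real l * x ^ (l - 1) * cosh x powr (- c))) (at_right 0)"
    unfolding filterlim_at_right_to_top set_lebesgue_integral_def .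
  moreover have "\<forall>\<^sub>F u in at_right 0. (LINT x:{0<..}|lborel. F u x)
      = (\<Sum>k. ((u * real (Suc k)) ^ l - (u * real k) ^ l) / hitting_denom c u (Suc k))"
    using small
  proof (rule eventually_mono)
    fix u :: real assume u: "u > 0 \<and> (1 + c)\<^sup>2 * (sinh u)\<^sup>2 \<le> c / 2 * u"
    have "set_integrable lborel {0<..} (F u)"
      unfolding set_integrable_def
      using bound u by (intro Bochner_Integration.integrable_bound[OF w meas]) (auto intro!: AE_I2 order_trans[OF _ abs_ge_self])
    then show "(LINT x:{0<..}|lborel. F u x)
      = (\<Sum>k. ((u * real (Suc k)) ^ l - (u * real k) ^ l) / hitting_denom c u (Suc k))"
      using u l set_integral_ceiling[of u l "\<lambda>k. 1 / hitting_denom c u k"] unfolding F_def by simp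
  qed
  ultimately show ?thesis
    by (auto simp: mult.assoc intro: Lim_transform_eventually)
qed

section \<open>Hitting times of the walk\<close>

lemma running_max_0 [simp]: "running_max X 0 \<omega> = X 0 \<omega>"
  by (simp add: running_max_def)

lemma running_max_Suc: "running_max X (Suc n) \<omega> = max (running_max X n \<omega>) (X (Suc n) \<omega>)"
  by (simp add: running_max_def atLeast0_atMost_Suc max.commute)

lemma le_running_max: "X n \<omega> \<le> running_max X n \<omega>"
  by (simp add: running_max_def)

lemma measurable_nat_pair:
  assumes "f \<in> measurable M (count_space UNIV)" "g \<in> measurable M (count_space UNIV)"
    and "\<And>i j. h i j \<in> space N"
  shows "(\<lambda>\<omega>. h (f \<omega> :: nat) (g \<omega> :: nat)) \<in> measurable M N"
proof (rule measurable_compose_countable[OF _ assms(2)])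
  show "(\<lambda>\<omega>. h (f \<omega>) j) \<in> measurable M N" for j
    using assms by (intro measurable_compose[OF assms(1)]) auto
qed

lemma measurable_running_max:
  assumes "\<And>i. i \<le> n \<Longrightarrow> X i \<in> measurable N (count_space UNIV)"
  shows "running_max X n \<in> measurable N (count_space UNIV)"
  using assms
proof (induction n)
  case 0
  then show ?case by (simp add: running_max_def)
next
  case (Suc n)
  have "(\<lambda>\<omega>. max (running_max X n \<omega>) (X (Suc n) \<omega>)) \<in> measurable N (count_space UNIV)"
    by (rule measurable_nat_pair[where h = max]) (use Suc in auto)
  then show ?case by (simp add: running_max_Suc[abs_def])
qed

lemma orrw_up_prob_bounds:
  assumes "c > 0"
  shows "\<bar>orrw_up_prob c x r\<bar> \<le> 1" "\<bar>1 - orrw_up_prob c x r\<bar> \<le> 1"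
  using assms by (auto simp: orrw_up_prob_def field_simps)

text \<open>In \<open>x\<close>, cosh (u * x) is the eigenfunction of the symmetric walk that is
  even, as reflection at 0 demands. Dividing by cosh (u * r) normalises the value at x = r to
  \<open>hitting_denom c u r\<close>, so that the function is constant on the event of first
  reaching a level.\<close>

definition walk_eigenfun :: "real \<Rightarrow> real \<Rightarrow> nat \<Rightarrow> nat \<Rightarrow> real" where
  "walk_eigenfun c u x r = hitting_denom c u r * cosh (u * real x) / cosh (u * real r)"

text \<open>At \<open>x = 0\<close> the truncated \<open>x - 1\<close> is harmless, as the down-step has weight \<open>0\<close> there.\<close>

lemma walk_eigenfun_step:
  assumes c: "c > 0" and "x \<le> r"
  shows "orrw_up_prob c x r * walk_eigenfun c u (x + 1) (max r (x + 1))
      + (1 - orrw_up_prob c x r) * walk_eigenfun c u (x - 1) r = cosh u * walk_eigenfun c u x r"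
proof -
  have plus: "cosh (u * real (x + 1)) = cosh (u * real x) * cosh u + sinh (u * real x) * sinh u"
    by (simp add: cosh_add[symmetric] distrib_left)
  have minus: "cosh (u * real (x - 1)) = cosh (u * real x) * cosh u - sinh (u * real x) * sinh u" if "x > 0"
    using that by (simp add: cosh_diff[symmetric] right_diff_distrib of_nat_diff)
  consider "x = 0" "r = 0" | "x = 0" "r > 0" | "0 < x" "x < r" | "0 < x" "x = r"
    using assms by linarith
  then show ?thesis
  proof cases
    case 1
    then show ?thesis by (simp add: orrw_up_prob_def walk_eigenfun_def hitting_denom_def)
  next
    case 2
    then have "max r (x + 1) = r" by simp
    with 2 show ?thesis by (simp add: orrw_up_prob_def walk_eigenfun_def)
  next
    case 3
    then have "max r (x + 1) = r" by simp
    with 3 show ?thesis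
      unfolding orrw_up_prob_def walk_eigenfun_def plus minus[OF 3(1)] by (simp add: field_simps)
  next
    case 4
    have "1 + c \<noteq> 0" using c by simp
    have up: "walk_eigenfun c u (x + 1) (max r (x + 1))
        = hitting_denom c u x * (cosh u + c * tanh (u * real x) * sinh u)"
      using 4 by (simp add: walk_eigenfun_def hitting_denom_Suc)
    have down: "walk_eigenfun c u (x - 1) r = hitting_denom c u x * (cosh u - tanh (u * real x) * sinh u)"
      unfolding walk_eigenfun_def minus[OF 4(1)] using 4 by (simp add: tanh_def field_simps)
    have here: "walk_eigenfun c u x r = hitting_denom c u x" using 4 by (simp add: walk_eigenfun_def)
    have p: "orrw_up_prob c x r = 1 / (1 + c)" "1 - orrw_up_prob c x r = c / (1 + c)"
      using 4 \<open>1 + c \<noteq> 0\<close> by (auto simp: orrw_up_prob_def field_simps)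
    \<comment> \<open>The terms in \<open>w\<close> carry the weights c / (1 + c) and - c / (1 + c)
      and cancel; this cancellation is what the choice of the factor in \<open>hitting_denom\<close>
      achieves.\<close>
    have "1 / (1 + c) * (h * (C + c * w)) + c / (1 + c) * (h * (C - w)) = C * h" for h C w :: real
      using \<open>1 + c \<noteq> 0\<close> by (simp add: divide_simps) (simp add: algebra_simps)
    from this[of "hitting_denom c u x" "cosh u" "tanh (u * real x) * sinh u"] show ?thesis
      unfolding up down here p(2) unfolding p(1) by (simp add: mult.assoc)
  qed
qed

section \<open>One-step expectations and first passage\<close>

context once_reinforced_walk
begin

lemma measurable_X_filtration:
  assumes "i \<le> n"
  shows "X i \<in> measurable (natural_filtration M X n) (count_space UNIV)"
proof (rule measurableI)
  fix A :: "nat set"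
  show "X i -` A \<inter> space (natural_filtration M X n) \<in> sets (natural_filtration M X n)"
    unfolding natural_filtration_def space_measure_of_conv
    using assms by (intro in_measure_of) (auto intro!: bexI[of _ i])
qed simp

lemma measurable_max_walk [measurable]: "running_max X n \<in> measurable M (count_space UNIV)"
  by (intro measurable_running_max measurable_X)

lemma sets_max_ge: "{\<omega> \<in> space M. k \<le> running_max X n \<omega>} \<in> events"
proof -
  have "{\<omega> \<in> space M. k \<le> running_max X n \<omega>} = running_max X n -` {k..} \<inter> space M" by auto
  then show ?thesis using measurable_sets[OF measurable_max_walk, of "{k..}" n] by simp
qed

lemma measurable_walk:
  "(\<lambda>\<omega>. h (X n \<omega>) (running_max X n \<omega>)) \<in> borel_measurable M" for h :: "nat \<Rightarrow> nat \<Rightarrow> real"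
  by (rule measurable_nat_pair[OF measurable_X measurable_max_walk]) simp

lemma measurable_walk_filtration:
  "(\<lambda>\<omega>. h (X n \<omega>) (running_max X n \<omega>)) \<in> borel_measurable (natural_filtration M X n)"
  for h :: "nat \<Rightarrow> nat \<Rightarrow> real"
  by (rule measurable_nat_pair) (auto intro!: measurable_X_filtration measurable_running_max)

definition up_step :: "nat \<Rightarrow> 'a set" where
  "up_step n = {\<omega> \<in> space M. X (n + 1) \<omega> = X n \<omega> + 1}"

definition down_step :: "nat \<Rightarrow> 'a set" where
  "down_step n = {\<omega> \<in> space M. int (X (n + 1) \<omega>) = int (X n \<omega>) - 1}"

lemma sets_steps [measurable]: "up_step n \<in> events" "down_step n \<in> events"
proof -
  have [measurable]: "Measurable.pred M (\<lambda>\<omega>. X i \<omega> = X j \<omega> + 1)" for i j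
    by (rule measurable_nat_pair[where h = "\<lambda>a b. a = b + 1"]) (auto intro: measurable_X)
  show "up_step n \<in> events" unfolding up_step_def by measurable
  have "down_step n = {\<omega> \<in> space M. X n \<omega> = X (n + 1) \<omega> + 1}"
    by (auto simp: down_step_def)
  also have "\<dots> \<in> events" by measurable
  finally show "down_step n \<in> events" .
qed

text \<open>Position and maximum at time \<open>n\<close> are measurable for the filtration at time
  \<open>n\<close>, so a bounded function of them can be moved past the conditional expectation of
  the step indicator, which the assumptions on the walk identify almost everywhere.\<close>

lemma
  fixes h :: "nat \<Rightarrow> nat \<Rightarrow> real" and n :: nat
  assumes bd: "\<And>x r. \<bar>h x r\<bar> \<le> B"
  shows step_up_expectation: "expectation (\<lambda>\<omega>. h (X n \<omega>) (running_max X n \<omega>) * indicator (up_step n) \<omega>)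
      = expectation (\<lambda>\<omega>. h (X n \<omega>) (running_max X n \<omega>) * orrw_up_prob c (X n \<omega>) (running_max X n \<omega>))"
    and step_down_expectation: "expectation (\<lambda>\<omega>. h (X n \<omega>) (running_max X n \<omega>) * indicator (down_step n) \<omega>)
      = expectation (\<lambda>\<omega>. h (X n \<omega>) (running_max X n \<omega>) * (1 - orrw_up_prob c (X n \<omega>) (running_max X n \<omega>)))"
proof -
  note [measurable] = measurable_X measurable_walk
  interpret F: finite_measure_subalgebra M "natural_filtration M X n"
    by unfold_locales (rule subalgebra_natural_filtration)
  have int: "integrable M (\<lambda>\<omega>. h (X n \<omega>) (running_max X n \<omega>) * indicator A \<omega>)" if [measurable]: "A \<in> sets M" for A
  proof (rule integrable_const_bound[where B = B])
    have "0 \<le> B" using bd[of 0 0] by simp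
    then show "AE \<omega> in M. norm (h (X n \<omega>) (running_max X n \<omega>) * indicator A \<omega>) \<le> B"
      using bd by (auto simp: indicator_def)
  qed measurable
  have *: "expectation (\<lambda>\<omega>. h (X n \<omega>) (running_max X n \<omega>) * real_cond_exp M (natural_filtration M X n) (indicator A) \<omega>)
      = expectation (\<lambda>\<omega>. h (X n \<omega>) (running_max X n \<omega>) * indicator A \<omega>)" if [measurable]: "A \<in> sets M" for A
    by (intro F.real_cond_exp_intg int measurable_walk_filtration) measurable
  have [measurable]: "real_cond_exp M (natural_filtration M X n) f \<in> borel_measurable M" for f
    by (rule borel_measurable_cond_exp2)
  show "expectation (\<lambda>\<omega>. h (X n \<omega>) (running_max X n \<omega>) * indicator (up_step n) \<omega>)
      = expectation (\<lambda>\<omega>. h (X n \<omega>) (running_max X n \<omega>) * orrw_up_prob c (X n \<omega>) (running_max X n \<omega>))"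
    unfolding *[OF sets_steps(1), symmetric]
    using step_up[of n] by (intro integral_cong_AE) (auto simp: up_step_def)
  show "expectation (\<lambda>\<omega>. h (X n \<omega>) (running_max X n \<omega>) * indicator (down_step n) \<omega>)
      = expectation (\<lambda>\<omega>. h (X n \<omega>) (running_max X n \<omega>) * (1 - orrw_up_prob c (X n \<omega>) (running_max X n \<omega>)))"
    unfolding *[OF sets_steps(2), symmetric]
    using step_down[of n] by (intro integral_cong_AE) (auto simp: down_step_def elim!: eventually_mono)
qed

text \<open>The assumptions give only the conditional probabilities of the two kinds of steps.
  Integrated, they show that the two disjoint step events have total probability 1, which excludes
  every other step.\<close>

lemma AE_step: "AE \<omega> in M. X (n + 1) \<omega> = X n \<omega> + 1 \<or> int (X (n + 1) \<omega>) = int (X n \<omega>) - 1"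
proof -
  have "integrable M (\<lambda>\<omega>. orrw_up_prob c (X n \<omega>) (running_max X n \<omega>))"
    by (rule integrable_const_bound[OF AE_I2 measurable_walk])
      (use orrw_up_prob_bounds[OF c_pos] in simp)
  then have "prob (up_step n) + prob (down_step n) = 1"
    using step_up_expectation[of "\<lambda>_ _. 1" 1 n] step_down_expectation[of "\<lambda>_ _. 1" 1 n]
    by (simp add: prob_space)
  moreover have "up_step n \<inter> down_step n = {}" by (auto simp: up_step_def down_step_def)
  then have "prob (up_step n \<union> down_step n) = prob (up_step n) + prob (down_step n)" by (intro finite_measure_Union) auto
  ultimately have "AE \<omega> in M. \<omega> \<in> up_step n \<union> down_step n" by (subst prob_eq_1[symmetric]) auto
  then show ?thesis by (auto simp: up_step_def down_step_def elim!: eventually_mono)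
qed

text \<open>Bounds are asked for only at the two reachable next positions, because the function to
  which this is applied is unbounded in its third argument.\<close>

lemma markov_expectation:
  fixes G :: "nat \<Rightarrow> nat \<Rightarrow> nat \<Rightarrow> real"
  assumes bd: "\<And>x r. \<bar>G x r (x + 1)\<bar> \<le> B" "\<And>x r. \<bar>G x r (x - 1)\<bar> \<le> B"
  shows "expectation (\<lambda>\<omega>. G (X n \<omega>) (running_max X n \<omega>) (X (n + 1) \<omega>))
    = expectation (\<lambda>\<omega>. orrw_up_prob c (X n \<omega>) (running_max X n \<omega>) * G (X n \<omega>) (running_max X n \<omega>) (X n \<omega> + 1)
        + (1 - orrw_up_prob c (X n \<omega>) (running_max X n \<omega>)) * G (X n \<omega>) (running_max X n \<omega>) (X n \<omega> - 1))"
proof -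
  note [measurable] = measurable_X measurable_walk
  have B: "0 \<le> B" using bd(1)[of 0 0] by simp
  have int: "integrable M (\<lambda>\<omega>. h (X n \<omega>) (running_max X n \<omega>) * g \<omega>)"
    if "\<And>x r. \<bar>h x r\<bar> \<le> B" "\<And>\<omega>. \<bar>g \<omega>\<bar> \<le> 1" and [measurable]: "g \<in> borel_measurable M"
    for h :: "nat \<Rightarrow> nat \<Rightarrow> real" and g
  proof (rule integrable_const_bound[where B = B])
    have "\<bar>h x r\<bar> * \<bar>g \<omega>\<bar> \<le> B * 1" for x r \<omega> using that B by (intro mult_mono) auto
    then show "AE \<omega> in M. norm (h (X n \<omega>) (running_max X n \<omega>) * g \<omega>) \<le> B"
      by (simp add: abs_mult)
  qed measurable
  have [measurable]: "(\<lambda>\<omega>. G (X n \<omega>) (running_max X n \<omega>) (X (n + 1) \<omega>)) \<in> borel_measurable M"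
    by (rule measurable_compose_countable[OF measurable_walk measurable_X])
  have "expectation (\<lambda>\<omega>. G (X n \<omega>) (running_max X n \<omega>) (X (n + 1) \<omega>))
    = expectation (\<lambda>\<omega>. G (X n \<omega>) (running_max X n \<omega>) (X n \<omega> + 1) * indicator (up_step n) \<omega>
        + G (X n \<omega>) (running_max X n \<omega>) (X n \<omega> - 1) * indicator (down_step n) \<omega>)"
  proof (rule integral_cong_AE)
    show "AE \<omega> in M. G (X n \<omega>) (running_max X n \<omega>) (X (n + 1) \<omega>) =
        G (X n \<omega>) (running_max X n \<omega>) (X n \<omega> + 1) * indicator (up_step n) \<omega>
        + G (X n \<omega>) (running_max X n \<omega>) (X n \<omega> - 1) * indicator (down_step n) \<omega>"
      using AE_step[of n] AE_space
    proof eventually_elim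
      case (elim \<omega>)
      \<comment> \<open>A down-step compared in \<open>int\<close> forces a positive current
        position, so the truncated subtraction agrees with the true one.\<close>
      then consider "X (n + 1) \<omega> = X n \<omega> + 1" | "X (n + 1) \<omega> = X n \<omega> - 1" "X n \<omega> > 0"
        by linarith
      then show ?case
        using elim by cases (auto simp: up_step_def down_step_def of_nat_diff)
    qed
  qed measurable
  also have "\<dots> = expectation (\<lambda>\<omega>. G (X n \<omega>) (running_max X n \<omega>) (X n \<omega> + 1) * indicator (up_step n) \<omega>)
      + expectation (\<lambda>\<omega>. G (X n \<omega>) (running_max X n \<omega>) (X n \<omega> - 1) * indicator (down_step n) \<omega>)"
    using bd by (intro Bochner_Integration.integral_add int[of "\<lambda>x r. G x r (x + 1)"] int[of "\<lambda>x r. G x r (x - 1)"])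
      (auto simp: indicator_def)
  finally have split: "expectation (\<lambda>\<omega>. G (X n \<omega>) (running_max X n \<omega>) (X (n + 1) \<omega>)) = expectation (\<lambda>\<omega>. G (X n \<omega>) (running_max X n \<omega>) (X n \<omega> + 1) * indicator (up_step n) \<omega>)
      + expectation (\<lambda>\<omega>. G (X n \<omega>) (running_max X n \<omega>) (X n \<omega> - 1) * indicator (down_step n) \<omega>)" .
  have up: "expectation (\<lambda>\<omega>. G (X n \<omega>) (running_max X n \<omega>) (X n \<omega> + 1) * indicator (up_step n) \<omega>)
      = expectation (\<lambda>\<omega>. G (X n \<omega>) (running_max X n \<omega>) (X n \<omega> + 1) * orrw_up_prob c (X n \<omega>) (running_max X n \<omega>))"
    using bd by (intro step_up_expectation[of "\<lambda>x r. G x r (x + 1)" B])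
  have down: "expectation (\<lambda>\<omega>. G (X n \<omega>) (running_max X n \<omega>) (X n \<omega> - 1) * indicator (down_step n) \<omega>)
      = expectation (\<lambda>\<omega>. G (X n \<omega>) (running_max X n \<omega>) (X n \<omega> - 1) * (1 - orrw_up_prob c (X n \<omega>) (running_max X n \<omega>)))"
    using bd by (intro step_down_expectation[of "\<lambda>x r. G x r (x - 1)" B])
  have i1: "integrable M (\<lambda>\<omega>. G (X n \<omega>) (running_max X n \<omega>) (X n \<omega> + 1) * orrw_up_prob c (X n \<omega>) (running_max X n \<omega>))"
    by (rule int[of "\<lambda>x r. G x r (x + 1)"]) (rule bd orrw_up_prob_bounds[OF c_pos] measurable_walk)+
  have i2: "integrable M (\<lambda>\<omega>. G (X n \<omega>) (running_max X n \<omega>) (X n \<omega> - 1) * (1 - orrw_up_prob c (X n \<omega>) (running_max X n \<omega>)))"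
    by (rule int[of "\<lambda>x r. G x r (x - 1)"])
      (rule bd orrw_up_prob_bounds[OF c_pos] measurable_walk[of "\<lambda>x r. 1 - orrw_up_prob c x r"])+
  have add: "expectation (\<lambda>\<omega>. G (X n \<omega>) (running_max X n \<omega>) (X n \<omega> + 1) * orrw_up_prob c (X n \<omega>) (running_max X n \<omega>))
      + expectation (\<lambda>\<omega>. G (X n \<omega>) (running_max X n \<omega>) (X n \<omega> - 1) * (1 - orrw_up_prob c (X n \<omega>) (running_max X n \<omega>)))
      = expectation (\<lambda>\<omega>. G (X n \<omega>) (running_max X n \<omega>) (X n \<omega> + 1) * orrw_up_prob c (X n \<omega>) (running_max X n \<omega>)
        + G (X n \<omega>) (running_max X n \<omega>) (X n \<omega> - 1) * (1 - orrw_up_prob c (X n \<omega>) (running_max X n \<omega>)))"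
    by (rule Bochner_Integration.integral_add[OF i1 i2, symmetric])
  show ?thesis unfolding split up down add by (simp add: mult.commute)
qed

text \<open>The difference of probabilities is that of first reaching \<open>k\<close> at time n +
  1. The eigenfunction is killed when the maximum reaches \<open>k\<close>, which makes it bounded;
  multiplying its expectation by cosh u gives the next expectation plus the mass lost by killing,
  and that mass carries the constant weight \<open>hitting_denom c u k\<close>. Discounting turns
  this recursion into a telescoping series, so no stopping theorem is involved.\<close>

lemma hitting_generating_function:
  assumes u: "u > 0" and k: "k \<ge> 1"
  shows "(\<lambda>n. (prob {\<omega> \<in> space M. k \<le> running_max X (Suc n) \<omega>} - prob {\<omega> \<in> space M. k \<le> running_max X n \<omega>})
      * (1 / cosh u) ^ Suc n) sums (1 / hitting_denom c u k)"
proof -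
  define H where "H = walk_eigenfun c u"
  define z where "z = 1 / cosh u"
  have "\<exists>B. \<forall>x\<in>{..k+1}. \<forall>r\<in>{..k+1}. \<bar>H x r\<bar> \<le> B"
  proof -
    have "bounded ((\<lambda>(x, r). H x r) ` ({..k+1} \<times> {..k+1}))" by (intro finite_imp_bounded) auto
    then show ?thesis by (auto simp: bounded_iff)
  qed
  then obtain B where B: "\<And>x r. x \<le> k + 1 \<Longrightarrow> r \<le> k + 1 \<Longrightarrow> \<bar>H x r\<bar> \<le> B" by auto
  have "\<bar>H 0 0\<bar> \<le> B" by (rule B) auto
  then have B0: "0 \<le> B" by linarith
  define e where "e n = expectation (\<lambda>\<omega>. if running_max X n \<omega> < k then H (X n \<omega>) (running_max X n \<omega>) else 0)" for n
  define d where "d n = prob {\<omega> \<in> space M. k \<le> running_max X (Suc n) \<omega>} - prob {\<omega> \<in> space M. k \<le> running_max X n \<omega>}" for n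
  have int: "integrable M (\<lambda>\<omega>. if running_max X n \<omega> < k then H (X n \<omega>) (running_max X n \<omega>) else 0)"
    and eB: "\<bar>e n\<bar> \<le> B" for n
  proof -
    have bd: "norm (if running_max X n \<omega> < k then H (X n \<omega>) (running_max X n \<omega>) else 0) \<le> B" for \<omega>
      using B[of "X n \<omega>" "running_max X n \<omega>"] B0 le_running_max[of X n \<omega>] by auto
    show i: "integrable M (\<lambda>\<omega>. if running_max X n \<omega> < k then H (X n \<omega>) (running_max X n \<omega>) else 0)"
      by (rule integrable_const_bound[OF AE_I2])
        (rule bd, rule measurable_walk[of "\<lambda>x r. if r < k then H x r else 0"])
    have "\<bar>e n\<bar> \<le> expectation (\<lambda>\<omega>. \<bar>if running_max X n \<omega> < k then H (X n \<omega>) (running_max X n \<omega>) else 0\<bar>)"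
      unfolding e_def by (rule integral_abs_bound)
    also have "\<dots> \<le> expectation (\<lambda>\<omega>. B)"
      using bd by (intro integral_mono integrable_abs i) simp_all
    finally show "\<bar>e n\<bar> \<le> B" by (simp add: prob_space)
  qed
  have step: "cosh u * e n = e (Suc n) + hitting_denom c u k * d n" for n
  proof -
    have passage: "{\<omega> \<in> space M. running_max X n \<omega> < k \<and> k \<le> running_max X (Suc n) \<omega>}
      = {\<omega> \<in> space M. k \<le> running_max X (Suc n) \<omega>} - {\<omega> \<in> space M. k \<le> running_max X n \<omega>}"
      by auto
    \<comment> \<open>The condition \<open>x \<le> r\<close> always holds along the walk. It is
      built in so that, together with \<open>r < k\<close>, both reachable values of
      \<open>x'\<close> are at most k and the bound \<open>B\<close> applies for all
      arguments.\<close>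
    define G where "G x r x' = (if x \<le> r \<and> r < k then H x' (max r x') else 0)" for x r x'
    have "cosh u * e n = expectation (\<lambda>\<omega>. cosh u * (if running_max X n \<omega> < k then H (X n \<omega>) (running_max X n \<omega>) else 0))"
      unfolding e_def by simp
    also have "\<dots> = expectation (\<lambda>\<omega>. orrw_up_prob c (X n \<omega>) (running_max X n \<omega>) * G (X n \<omega>) (running_max X n \<omega>) (X n \<omega> + 1)
        + (1 - orrw_up_prob c (X n \<omega>) (running_max X n \<omega>)) * G (X n \<omega>) (running_max X n \<omega>) (X n \<omega> - 1))"
    proof (rule Bochner_Integration.integral_cong[OF refl])
      fix \<omega>
      have "max (running_max X n \<omega>) (X n \<omega> - 1) = running_max X n \<omega>"
        using le_running_max[of X n \<omega>] by simp
      then show "cosh u * (if running_max X n \<omega> < k then H (X n \<omega>) (running_max X n \<omega>) else 0)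
        = orrw_up_prob c (X n \<omega>) (running_max X n \<omega>) * G (X n \<omega>) (running_max X n \<omega>) (X n \<omega> + 1)
        + (1 - orrw_up_prob c (X n \<omega>) (running_max X n \<omega>)) * G (X n \<omega>) (running_max X n \<omega>) (X n \<omega> - 1)"
        using walk_eigenfun_step[OF c_pos le_running_max[of X n \<omega>], of u] le_running_max[of X n \<omega>]
        by (simp add: G_def H_def)
    qed
    also have "\<dots> = expectation (\<lambda>\<omega>. G (X n \<omega>) (running_max X n \<omega>) (X (n + 1) \<omega>))"
      using B B0 by (intro markov_expectation[symmetric, where B = B]) (auto simp: G_def)
    also have "\<dots> = expectation (\<lambda>\<omega>. (if running_max X (Suc n) \<omega> < k then H (X (Suc n) \<omega>) (running_max X (Suc n) \<omega>) else 0)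
        + hitting_denom c u k * indicator {\<omega> \<in> space M. running_max X n \<omega> < k \<and> k \<le> running_max X (Suc n) \<omega>} \<omega>)"
    proof (rule integral_cong_AE)
      show "AE \<omega> in M. G (X n \<omega>) (running_max X n \<omega>) (X (n + 1) \<omega>)
        = (if running_max X (Suc n) \<omega> < k then H (X (Suc n) \<omega>) (running_max X (Suc n) \<omega>) else 0)
        + hitting_denom c u k * indicator {\<omega> \<in> space M. running_max X n \<omega> < k \<and> k \<le> running_max X (Suc n) \<omega>} \<omega>"
        using AE_step[of n] AE_space
      proof eventually_elim
        case (elim \<omega>)
        have le: "X n \<omega> \<le> running_max X n \<omega>" by (rule le_running_max)
        consider "k \<le> running_max X n \<omega>" | "running_max X (Suc n) \<omega> < k"
          | "running_max X n \<omega> < k" "k \<le> running_max X (Suc n) \<omega>" by linarith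
        then show ?case
        proof cases
          case 1
          then show ?thesis by (auto simp: G_def running_max_Suc)
        next
          case 2
          then have "\<omega> \<notin> {\<omega> \<in> space M. running_max X n \<omega> < k \<and> k \<le> running_max X (Suc n) \<omega>}" by auto
          then show ?thesis using 2 le by (simp add: G_def running_max_Suc)
        next
          case 3
          \<comment> \<open>Since upward steps have size 1, the walk cannot overshoot: on first
            passage it stands exactly at k, where position and maximum agree and the hyperbolic
            cosines in the eigenfunction cancel.\<close>
          then have "k \<le> X (Suc n) \<omega>" by (simp add: running_max_Suc)
          moreover have "X (Suc n) \<omega> \<le> X n \<omega> + 1" using elim(1) by auto
          ultimately have Xk: "X (Suc n) \<omega> = k" using le 3 by linarith
          then have Rk: "running_max X (Suc n) \<omega> = k" using 3 by (simp add: running_max_Suc)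
          have "G (X n \<omega>) (running_max X n \<omega>) (X (n + 1) \<omega>) = hitting_denom c u k"
            using 3 le Xk by (simp add: G_def H_def walk_eigenfun_def)
          moreover have "\<omega> \<in> {\<omega> \<in> space M. running_max X n \<omega> < k \<and> k \<le> running_max X (Suc n) \<omega>}"
            using 3 elim by simp
          ultimately show ?thesis using Rk by simp
        qed
      qed
      show "(\<lambda>\<omega>. G (X n \<omega>) (running_max X n \<omega>) (X (n + 1) \<omega>)) \<in> borel_measurable M"
        by (rule measurable_compose_countable[OF measurable_walk measurable_X])
      have m: "(\<lambda>\<omega>. if running_max X (Suc n) \<omega> < k then H (X (Suc n) \<omega>) (running_max X (Suc n) \<omega>) else 0) \<in> borel_measurable M"
        using int[of "Suc n"] by (rule borel_measurable_integrable)
      show "(\<lambda>\<omega>. (if running_max X (Suc n) \<omega> < k then H (X (Suc n) \<omega>) (running_max X (Suc n) \<omega>) else 0)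
        + hitting_denom c u k * indicator {\<omega> \<in> space M. running_max X n \<omega> < k \<and> k \<le> running_max X (Suc n) \<omega>} \<omega>) \<in> borel_measurable M"
      proof (intro borel_measurable_add m borel_measurable_times borel_measurable_const borel_measurable_indicator)
        show "{\<omega> \<in> space M. running_max X n \<omega> < k \<and> k \<le> running_max X (Suc n) \<omega>} \<in> events"
          unfolding passage by (intro sets.Diff sets_max_ge)
      qed
    qed
    also have "\<dots> = e (Suc n) + hitting_denom c u k * prob {\<omega> \<in> space M. running_max X n \<omega> < k \<and> k \<le> running_max X (Suc n) \<omega>}"
      unfolding e_def passage
      by (subst Bochner_Integration.integral_add[OF int])
        (simp_all add: sets_max_ge sets.Diff emeasure_eq_measure Int_absorb1)
    finally have *: "cosh u * e n = e (Suc n) + hitting_denom c u k * prob {\<omega> \<in> space M. running_max X n \<omega> < k \<and> k \<le> running_max X (Suc n) \<omega>}" .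
    have "prob {\<omega> \<in> space M. running_max X n \<omega> < k \<and> k \<le> running_max X (Suc n) \<omega>} = d n"
    proof -
      have sub: "{\<omega> \<in> space M. k \<le> running_max X n \<omega>} \<subseteq> {\<omega> \<in> space M. k \<le> running_max X (Suc n) \<omega>}"
        by (auto simp: running_max_Suc)
      show ?thesis unfolding passage d_def by (rule finite_measure_Diff[OF sets_max_ge sets_max_ge sub])
    qed
    with * show ?thesis by simp
  qed
  have cu: "cosh u > 1" using u cosh_real_strict_mono[of 0 u] by simp
  have z: "0 < z" "z < 1" "z * cosh u = 1" using cu by (auto simp: z_def)
  \<comment> \<open>The killed expectations stay within \<open>B\<close> while z < 1, so the
    boundary term of the telescoping series disappears and only \<open>e 0 = 1\<close>
    remains.\<close>
  have "(\<lambda>n. z ^ n * e n) \<longlonglongrightarrow> 0"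
  proof (rule Lim_null_comparison)
    show "\<forall>\<^sub>F n in sequentially. norm (z ^ n * e n) \<le> z ^ n * B"
      using eB z by (auto simp: abs_mult)
    show "(\<lambda>n. z ^ n * B) \<longlonglongrightarrow> 0"
      using z by (intro tendsto_mult_left_zero LIMSEQ_power_zero) auto
  qed
  from telescope_sums'[OF this]
  have "(\<lambda>n. z ^ n * e n - z ^ Suc n * e (Suc n)) sums (e 0)" by simp
  moreover have "z ^ n * e n - z ^ Suc n * e (Suc n) = hitting_denom c u k * (d n * z ^ Suc n)" for n
  proof -
    have "z ^ n * e n = z ^ n * (z * cosh u) * e n" using z by simp
    also have "\<dots> = z ^ Suc n * (cosh u * e n)" by simp
    finally show ?thesis unfolding step by (simp add: algebra_simps)
  qed
  moreover have "e 0 = 1"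
  proof -
    have "e 0 = expectation (\<lambda>\<omega>. 1)" unfolding e_def
    proof (rule integral_cong_AE)
      show "AE \<omega> in M. (if running_max X 0 \<omega> < k then H (X 0 \<omega>) (running_max X 0 \<omega>) else 0) = 1"
        using start by eventually_elim (use k in \<open>simp add: H_def walk_eigenfun_def hitting_denom_def\<close>)
    qed (use int[of 0] in \<open>auto dest: borel_measurable_integrable\<close>)
    then show ?thesis by (simp add: prob_space)
  qed
  ultimately have "(\<lambda>n. hitting_denom c u k * (d n * z ^ Suc n)) sums 1" by simp
  from sums_divide[OF this, of "hitting_denom c u k"]
  show ?thesis
    using hitting_denom_pos[OF c_pos, of u k] u unfolding d_def z_def by simp
qed

end

section \<open>Moments of the maximum\<close>

text \<open>Half of the exponential rate absorbs the power, and the other half leaves a geometric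
  series.\<close>

lemma summable_power_mult_exp:
  fixes s :: real
  assumes s: "s > 0"
  shows "summable (\<lambda>n. real n ^ l * exp (- (s * real n)))"
proof -
  have "filterlim (\<lambda>n. s / 2 * real n) at_top sequentially"
    using s by (intro filterlim_tendsto_pos_mult_at_top[OF tendsto_const] filterlim_real_sequentially) auto
  from filterlim_compose[OF tendsto_power_div_exp_0 this, of l]
  have "Bseq (\<lambda>n. (s / 2 * real n) ^ l / exp (s / 2 * real n))"
    by (intro convergent_imp_Bseq convergentI)
  then obtain B where B: "\<And>n. norm ((s / 2 * real n) ^ l / exp (s / 2 * real n)) \<le> B"
    by (auto simp: Bseq_def)
  show ?thesis
  proof (rule summable_comparison_test'[where N = 0])
    show "summable (\<lambda>n. B / (s / 2) ^ l * exp (- (s / 2)) ^ n)"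
      using s by (intro summable_mult summable_geometric) auto
    fix n :: nat
    have "(s / 2) ^ l * real n ^ l \<le> B * exp (s / 2 * real n)"
      using B[of n] s by (simp add: power_mult_distrib[symmetric] divide_le_eq)
    then have "real n ^ l \<le> B / (s / 2) ^ l * exp (s / 2 * real n)"
      using s by (simp add: field_simps)
    then have "real n ^ l * exp (- (s * real n)) \<le> B / (s / 2) ^ l * exp (s / 2 * real n) * exp (- (s * real n))"
      by (intro mult_right_mono) auto
    also have "\<dots> = B / (s / 2) ^ l * exp (- (s / 2)) ^ n"
      by (simp add: exp_of_nat_mult[symmetric] exp_add[symmetric] mult.assoc)
    finally show "norm (real n ^ l * exp (- (s * real n))) \<le> B / (s / 2) ^ l * exp (- (s / 2)) ^ n"
      by simp
  qed
qed

text \<open>Tonelli in the extended nonnegative reals. Summability is assumed on one side only and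
  obtained on the other; in the application \<open>i\<close> is the time, over which summability is
  known, and \<open>j\<close> is the level.\<close>

lemma sums_swap_nonneg:
  fixes f :: "nat \<Rightarrow> nat \<Rightarrow> real"
  assumes nn: "\<And>i j. f i j \<ge> 0"
    and S: "\<And>j. (\<lambda>i. f i j) sums S j" and T: "\<And>i. (\<lambda>j. f i j) sums T i"
    and sm: "summable T"
  shows "S sums suminf T"
proof -
  have S0: "S j \<ge> 0" for j
    using suminf_nonneg[OF sums_summable[OF S[of j]] nn] sums_unique[OF S[of j]] by simp
  have T0: "T i \<ge> 0" for i
    using suminf_nonneg[OF sums_summable[OF T[of i]] nn] sums_unique[OF T[of i]] by simp
  have "(\<Sum>j. ennreal (S j)) = (\<Sum>j. \<Sum>i. ennreal (f i j))"
    using suminf_ennreal_eq[OF nn S] by simp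
  also have "\<dots> = (\<integral>\<^sup>+j. (\<Sum>i. ennreal (f i j)) \<partial>count_space UNIV)"
    by (simp add: nn_integral_count_space_nat)
  also have "\<dots> = (\<Sum>i. \<integral>\<^sup>+j. ennreal (f i j) \<partial>count_space UNIV)"
    by (rule nn_integral_suminf) simp
  also have "\<dots> = (\<Sum>i. \<Sum>j. ennreal (f i j))"
    by (simp add: nn_integral_count_space_nat)
  also have "\<dots> = (\<Sum>i. ennreal (T i))"
    using suminf_ennreal_eq[OF nn T] by simp
  also have "\<dots> = ennreal (suminf T)"
    by (rule suminf_ennreal_eq[OF T0 summable_sums[OF sm]])
  finally have eq: "(\<Sum>j. ennreal (S j)) = ennreal (suminf T)" .
  then have "summable S" using S0 by (intro summable_suminf_not_top) auto
  moreover have "suminf S = suminf T"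
    using eq suminf_ennreal_eq[OF S0 summable_sums[OF \<open>summable S\<close>]]
    by (simp add: suminf_nonneg[OF sm T0] suminf_nonneg[OF \<open>summable S\<close> S0])
  ultimately show ?thesis using summable_sums by metis
qed

text \<open>The layer-cake formula for l-th powers by telescoping. The free upper limit
  \<open>m\<close> allows moments at consecutive times to be written over one common range and
  subtracted termwise.\<close>

lemma power_eq_sum_indicator:
  assumes "r \<le> m" "l \<ge> 1"
  shows "real r ^ l = (\<Sum>j<m. (real (Suc j) ^ l - real j ^ l) * indicator {Suc j..} r)"
proof -
  have "(\<Sum>j<m. (real (Suc j) ^ l - real j ^ l) * indicator {Suc j..} r)
      = (\<Sum>j<r. real (Suc j) ^ l - real j ^ l)"
    using assms by (intro sum.mono_neutral_cong_right) (auto simp: indicator_def)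
  also have "\<dots> = real r ^ l - real 0 ^ l"
    by (rule sum_lessThan_telescope)
  finally show ?thesis using assms by simp
qed

section \<open>Increments of the moments and their Laplace transform\<close>

context once_reinforced_walk
begin

lemma AE_running_max_le: "AE \<omega> in M. running_max X n \<omega> \<le> n"
proof (induction n)
  case 0
  show ?case using start by eventually_elim simp
next
  case (Suc n)
  show ?case using Suc AE_step[of n]
  proof eventually_elim
    case (elim \<omega>)
    then have "X (Suc n) \<omega> \<le> X n \<omega> + 1" by auto
    then show ?case using elim le_running_max[of X n \<omega>] by (simp add: running_max_Suc)
  qed
qed

lemma moment_eq_sum:
  assumes "n \<le> m" "l \<ge> 1"
  shows "expectation (\<lambda>\<omega>. real (running_max X n \<omega>) ^ l)
    = (\<Sum>j<m. (real (Suc j) ^ l - real j ^ l) * prob {\<omega> \<in> space M. Suc j \<le> running_max X n \<omega>})"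
proof -
  let ?E = "\<lambda>j. {\<omega> \<in> space M. Suc j \<le> running_max X n \<omega>}"
  have "expectation (\<lambda>\<omega>. real (running_max X n \<omega>) ^ l)
    = expectation (\<lambda>\<omega>. \<Sum>j<m. (real (Suc j) ^ l - real j ^ l) * indicator (?E j) \<omega>)"
  proof (rule integral_cong_AE)
    show "AE \<omega> in M. real (running_max X n \<omega>) ^ l
        = (\<Sum>j<m. (real (Suc j) ^ l - real j ^ l) * indicator (?E j) \<omega>)"
      using AE_running_max_le[of n] AE_space
    proof eventually_elim
      case (elim \<omega>)
      have "real (running_max X n \<omega>) ^ l
        = (\<Sum>j<m. (real (Suc j) ^ l - real j ^ l) * indicator {Suc j..} (running_max X n \<omega>))"
        using elim assms by (intro power_eq_sum_indicator) auto
      also have "\<dots> = (\<Sum>j<m. (real (Suc j) ^ l - real j ^ l) * indicator (?E j) \<omega>)"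
        using elim by (intro sum.cong refl) (simp add: indicator_def)
      finally show ?case .
    qed
    show "(\<lambda>\<omega>. real (running_max X n \<omega>) ^ l) \<in> borel_measurable M"
      by (rule measurable_walk[of "\<lambda>x r. real r ^ l"])
    show "(\<lambda>\<omega>. \<Sum>j<m. (real (Suc j) ^ l - real j ^ l) * indicator (?E j) \<omega>) \<in> borel_measurable M"
      by (intro borel_measurable_sum borel_measurable_times borel_measurable_const
          borel_measurable_indicator sets_max_ge)
  qed
  also have "\<dots> = (\<Sum>j<m. (real (Suc j) ^ l - real j ^ l) * prob (?E j))"
  proof (subst Bochner_Integration.integral_sum)
    show "integrable M (\<lambda>\<omega>. (real (Suc j) ^ l - real j ^ l) * indicator (?E j) \<omega>)" for j
      by (intro integrable_mult_right integrable_real_indicator sets_max_ge)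
        (simp add: emeasure_eq_measure)
    show "(\<Sum>j<m. expectation (\<lambda>\<omega>. (real (Suc j) ^ l - real j ^ l) * indicator (?E j) \<omega>))
      = (\<Sum>j<m. (real (Suc j) ^ l - real j ^ l) * prob (?E j))"
      by (intro sum.cong refl) (simp add: Int_absorb1)
  qed
  finally show ?thesis .
qed

text \<open>Indexed so that the partial sums up to n are the moments at time n, the form required by
  the Tauberian theorem. The value 0 at n = 0 is consistent because the walk starts at 0 almost
  surely and l is at least 1 where this is used.\<close>

definition moment_increment :: "nat \<Rightarrow> nat \<Rightarrow> real" where
  "moment_increment l n = (if n = 0 then 0 else
    expectation (\<lambda>\<omega>. real (running_max X n \<omega>) ^ l) - expectation (\<lambda>\<omega>. real (running_max X (n - 1) \<omega>) ^ l))"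

lemma moment_0: "l \<ge> 1 \<Longrightarrow> expectation (\<lambda>\<omega>. real (running_max X 0 \<omega>) ^ l) = 0"
  by (subst moment_eq_sum[where m = 0]) auto

lemma sum_moment_increment:
  assumes "l \<ge> 1"
  shows "(\<Sum>k\<le>n. moment_increment l k) = expectation (\<lambda>\<omega>. real (running_max X n \<omega>) ^ l)"
proof (induction n)
  case 0
  show ?case using moment_0[OF assms] by (simp add: moment_increment_def)
next
  case (Suc n)
  have "(\<Sum>k\<le>Suc n. moment_increment l k)
      = expectation (\<lambda>\<omega>. real (running_max X n \<omega>) ^ l) + moment_increment l (Suc n)"
    using Suc by simp
  then show ?case by (simp add: moment_increment_def)
qed

lemma moment_le: "expectation (\<lambda>\<omega>. real (running_max X n \<omega>) ^ l) \<le> real n ^ l"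
proof -
  have "expectation (\<lambda>\<omega>. real (running_max X n \<omega>) ^ l) \<le> expectation (\<lambda>_. real n ^ l)"
  proof (rule integral_mono_AE')
    show "AE \<omega> in M. real (running_max X n \<omega>) ^ l \<le> real n ^ l"
      using AE_running_max_le[of n] by eventually_elim (auto intro: power_mono)
  qed auto
  then show ?thesis by (simp add: prob_space)
qed

lemma prob_max_mono:
  "prob {\<omega> \<in> space M. k \<le> running_max X n \<omega>} \<le> prob {\<omega> \<in> space M. k \<le> running_max X (Suc n) \<omega>}"
  by (intro finite_measure_mono sets_max_ge) (auto simp: running_max_Suc)

lemma moment_increment_Suc:
  assumes "l \<ge> 1" "Suc n \<le> m"
  shows "moment_increment l (Suc n) = (\<Sum>j<m. (real (Suc j) ^ l - real j ^ l) *
    (prob {\<omega> \<in> space M. Suc j \<le> running_max X (Suc n) \<omega>} - prob {\<omega> \<in> space M. Suc j \<le> running_max X n \<omega>}))"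
  unfolding moment_increment_def
  using moment_eq_sum[of "Suc n" m l] moment_eq_sum[of n m l] assms
  by (simp add: sum_subtractf[symmetric] right_diff_distrib)

lemma power_increment_nonneg: "0 \<le> real (Suc j) ^ l - real j ^ l"
  by (simp add: power_mono)

lemma moment_increment_nonneg:
  assumes "l \<ge> 1"
  shows "0 \<le> moment_increment l n"
proof (cases n)
  case (Suc m)
  show ?thesis unfolding Suc moment_increment_Suc[OF assms order_refl]
    using prob_max_mono by (intro sum_nonneg mult_nonneg_nonneg power_increment_nonneg) simp
qed (simp add: moment_increment_def)

lemma summable_moment_increment:
  assumes l: "l \<ge> 1" and s: "s > 0"
  shows "summable (\<lambda>n. moment_increment l n * exp (- (s * real n)))"
proof (rule summable_comparison_test'[OF summable_power_mult_exp[OF s, of l], of 0])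
  fix n
  have "moment_increment l n \<le> real n ^ l"
  proof (cases "n = 0")
    case False
    have "0 \<le> expectation (\<lambda>\<omega>. real (running_max X (n - 1) \<omega>) ^ l)" by simp
    then show ?thesis using False moment_le[of n l] unfolding moment_increment_def if_not_P[OF False] by linarith
  qed (simp add: moment_increment_def)
  then show "norm (moment_increment l n * exp (- (s * real n))) \<le> real n ^ l * exp (- (s * real n))"
    using moment_increment_nonneg[OF l, of n] by (simp add: abs_mult)
qed

text \<open>Each increment is a weighted sum over levels of first passage probabilities.
  Interchanging the sums over times and levels leaves, for each level, its hitting time transform;
  the interchange is permitted since all terms are nonnegative. For fixed time only finitely many
  levels contribute, because the maximum at time n + 1 is at most n + 1.\<close>

lemma moment_generating_function:
  assumes l: "l \<ge> 1" and u: "u > 0"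
  shows "(\<lambda>j. (real (Suc j) ^ l - real j ^ l) / hitting_denom c u (Suc j))
    sums (\<Sum>n. moment_increment l n * exp (- (ln (cosh u) * real n)))"
proof -
  define d where "d n j = prob {\<omega> \<in> space M. Suc j \<le> running_max X (Suc n) \<omega>}
    - prob {\<omega> \<in> space M. Suc j \<le> running_max X n \<omega>}" for n j
  define w where "w j = real (Suc j) ^ l - real j ^ l" for j
  define z where "z = 1 / cosh u"
  have cu: "cosh u > 1" using u cosh_real_strict_mono[of 0 u] by simp
  have z: "exp (- (ln (cosh u) * real n)) = z ^ n" for n
    by (simp add: z_def exp_minus exp_of_nat2_mult power_one_over inverse_eq_divide)
  have s: "ln (cosh u) > 0" using cu by simp
  note sm = summable_moment_increment[OF l s, unfolded z]
  have "(\<lambda>j. w j * (1 / hitting_denom c u (Suc j))) sums (\<Sum>n. moment_increment l (Suc n) * z ^ Suc n)"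
  proof (rule sums_swap_nonneg[where f = "\<lambda>n j. w j * (d n j * z ^ Suc n)"])
    show "0 \<le> w j * (d n j * z ^ Suc n)" for n j
      using prob_max_mono[of "Suc j" n] power_increment_nonneg[of j l] cu
      by (auto simp: w_def d_def z_def intro!: mult_nonneg_nonneg)
    show "(\<lambda>n. w j * (d n j * z ^ Suc n)) sums (w j * (1 / hitting_denom c u (Suc j)))" for j
      unfolding d_def z_def using u by (intro sums_mult hitting_generating_function) auto
    show "(\<lambda>j. w j * (d n j * z ^ Suc n)) sums (moment_increment l (Suc n) * z ^ Suc n)" for n
    proof -
      have "moment_increment l (Suc n) * z ^ Suc n = (\<Sum>j<Suc n. w j * (d n j * z ^ Suc n))"
        unfolding moment_increment_Suc[OF l order_refl] w_def d_def
        by (simp only: sum_distrib_right mult.assoc)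
      moreover have "d n j = 0" if "j \<ge> Suc n" for j
      proof -
        have "prob {\<omega> \<in> space M. Suc j \<le> running_max X i \<omega>} = 0" if "i \<le> Suc n" for i
        proof -
          have "AE \<omega> in M. \<not> Suc j \<le> running_max X i \<omega>"
            using AE_running_max_le[of i] by eventually_elim (use that \<open>j \<ge> Suc n\<close> in simp)
          then show ?thesis using prob_eq_0[OF sets_max_ge, of "Suc j" i] by simp
        qed
        then show ?thesis by (simp add: d_def)
      qed
      ultimately show ?thesis
        using sums_finite[of "{..<Suc n}" "\<lambda>j. w j * (d n j * z ^ Suc n)"] by auto
    qed
    show "summable (\<lambda>n. moment_increment l (Suc n) * z ^ Suc n)"
      using sm by (subst summable_Suc_iff)
  qed
  also have "(\<Sum>n. moment_increment l (Suc n) * z ^ Suc n) = (\<Sum>n. moment_increment l n * z ^ n)"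
    using suminf_split_head[OF sm] by (simp add: moment_increment_def)
  finally show ?thesis unfolding w_def z by simp
qed

text \<open>In terms of u, with s = ln (cosh u), the power s^(l/2) splits into (s / u^2)^(l/2) and
  u^l. The first factor tends to 2^(-l/2), and the second rescales the levels in the sum to the grid
  u * k.\<close>

lemma moment_laplace_limit:
  assumes l: "l \<ge> 1"
  shows "((\<lambda>s. s powr (real l / 2) * (\<Sum>n. moment_increment l n * exp (- (s * real n))))
    \<longlongrightarrow> (1 / 2) powr (real l / 2) * (real l * (LINT x:{0<..}|lborel. x ^ (l - 1) * cosh x powr (- c)))) (at_right 0)"
    (is "(?L \<longlongrightarrow> ?K) _")
proof -
  have "((\<lambda>u. (ln (cosh u) / u\<^sup>2) powr (real l / 2) *
      (\<Sum>k. ((u * real (Suc k)) ^ l - (u * real k) ^ l) / hitting_denom c u (Suc k))) \<longlongrightarrow> ?K) (at_right 0)"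
  proof (intro tendsto_mult tendsto_powr tendsto_const tendsto_hitting_sum[OF c_pos l])
    show "((\<lambda>u::real. ln (cosh u) / u\<^sup>2) \<longlongrightarrow> 1 / 2) (at_right 0)" by real_asymp
  qed auto
  moreover have "\<forall>\<^sub>F u in at_right 0. (ln (cosh u) / u\<^sup>2) powr (real l / 2) *
      (\<Sum>k. ((u * real (Suc k)) ^ l - (u * real k) ^ l) / hitting_denom c u (Suc k)) = ?L (ln (cosh u))"
  proof (rule eventually_mono[OF eventually_at_right_less[of 0]])
    fix u :: real assume u: "u > 0"
    have "(\<Sum>k. ((u * real (Suc k)) ^ l - (u * real k) ^ l) / hitting_denom c u (Suc k))
        = (\<Sum>k. u ^ l * ((real (Suc k) ^ l - real k ^ l) / hitting_denom c u (Suc k)))"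
      by (simp only: power_mult_distrib right_diff_distrib times_divide_eq_right)
    also have "\<dots> = u ^ l * (\<Sum>n. moment_increment l n * exp (- (ln (cosh u) * real n)))"
      using sums_mult[OF moment_generating_function[OF l u], of "u ^ l"] by (rule sums_unique[symmetric])
    finally have eq: "(\<Sum>k. ((u * real (Suc k)) ^ l - (u * real k) ^ l) / hitting_denom c u (Suc k))
        = u ^ l * (\<Sum>n. moment_increment l n * exp (- (ln (cosh u) * real n)))" .
    have "u\<^sup>2 powr (real l / 2) = (u powr 2) powr (real l / 2)" using u by simp
    also have "\<dots> = u powr real l" by (simp add: powr_powr)
    also have "\<dots> = u ^ l" using u by (rule powr_realpow)
    finally have "u\<^sup>2 powr (real l / 2) = u ^ l" .
    moreover have "0 \<le> ln (cosh u)" using cosh_real_ge_1[of u] by simp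
    ultimately have "(ln (cosh u) / u\<^sup>2) powr (real l / 2) = ln (cosh u) powr (real l / 2) / u ^ l"
      by (simp add: powr_divide)
    then show "(ln (cosh u) / u\<^sup>2) powr (real l / 2) *
      (\<Sum>k. ((u * real (Suc k)) ^ l - (u * real k) ^ l) / hitting_denom c u (Suc k)) = ?L (ln (cosh u))"
      unfolding eq using u by simp
  qed
  ultimately have lim: "((\<lambda>u. ?L (ln (cosh u))) \<longlongrightarrow> ?K) (at_right 0)"
    by (rule Lim_transform_eventually)
  \<comment> \<open>The limit is known along s = ln (cosh u). Inverting this substitution by u =
    arcosh (exp s), which tends to 0 from the right together with s, gives it for all small positive
    s.\<close>
  have "filterlim (\<lambda>s::real. arcosh (exp s)) (at_right 0) (at_right 0)"
  proof (rule filterlim_compose[of arcosh])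
    show "filterlim arcosh (at_right 0) (at_right (1::real))"
      unfolding filterlim_at using tendsto_arcosh_at_left_1
      by (auto intro!: eventually_mono[OF eventually_at_right_less[of 1]])
    show "filterlim exp (at_right 1) (at_right (0::real))"
      unfolding filterlim_at
      by (auto intro!: tendsto_eq_intros eventually_mono[OF eventually_at_right_less[of 0]])
  qed
  from filterlim_compose[OF lim this]
  have "((\<lambda>s. ?L (ln (cosh (arcosh (exp s))))) \<longlongrightarrow> ?K) (at_right 0)" .
  moreover have "\<forall>\<^sub>F s in at_right 0. ?L (ln (cosh (arcosh (exp s)))) = ?L s"
    by (rule eventually_mono[OF eventually_at_right_less[of 0]]) simp
  ultimately show ?thesis by (rule Lim_transform_eventually)
qed

text \<open>The identity behind this is 2 * exp x / (exp (2 * x) + 1) = 1 / cosh x, raised to the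
  power c.\<close>

lemma orrw_J_eq: "orrw_J l c = (LINT x:{0<..}|lborel. x ^ (l - 1) * cosh x powr (- c))"
proof -
  have "2 powr c * (exp x / (exp (2 * x) + 1)) powr c = cosh x powr (- c)" for x :: real
  proof -
    have "cosh x = (exp (2 * x) + 1) / (2 * exp x)"
      by (simp add: cosh_field_def exp_minus field_simps exp_add[symmetric])
    moreover have "exp (2 * x) + 1 > 0" by (intro add_pos_pos) auto
    ultimately have "2 * (exp x / (exp (2 * x) + 1)) = 1 / cosh x" by (simp add: field_simps)
    moreover have "2 powr c * (exp x / (exp (2 * x) + 1)) powr c = (2 * (exp x / (exp (2 * x) + 1))) powr c"
      by (rule powr_mult[symmetric])
    ultimately show ?thesis by (simp add: powr_minus powr_divide inverse_eq_divide)
  qed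
  then have eq: "2 powr c * (x ^ (l - 1) * (exp x / (exp (2 * x) + 1)) powr c) = x ^ (l - 1) * cosh x powr (- c)"
    for x :: real by (metis mult.left_commute)
  show ?thesis
    unfolding orrw_J_def by (simp only: set_integral_mult_right[symmetric] eq)
qed

text \<open>Integrability has to be established along the way: a non-integrable function has Bochner
  integral 0 by convention, so positivity of the integrand would not suffice.\<close>

lemma orrw_J_pos:
  assumes l: "l \<ge> 1"
  shows "orrw_J l c > 0"
proof -
  let ?f = "\<lambda>x::real. indicator {0<..} x *\<^sub>R (x ^ (l - 1) * cosh x powr (- c))"
  have [measurable]: "(\<lambda>x::real. cosh x) \<in> borel_measurable borel"
    by (intro borel_measurable_continuous_onI continuous_intros)
  have int: "integrable lborel ?f"
  proof (rule Bochner_Integration.integrable_bound)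
    show "integrable lborel (\<lambda>x. indicator {0<..} x *\<^sub>R (2 powr c * (x ^ (l - 1) * exp (- (c * x)))))"
      using set_integrable_mult_right[OF set_integrable_power_exp[OF c_pos l]]
      unfolding set_integrable_def by blast
    have bound: "cosh x powr (- c) \<le> 2 powr c * exp (- (c * x))" for x :: real
    proof -
      have "exp x / 2 \<le> cosh x" by (simp add: cosh_field_def)
      then have "cosh x powr (- c) \<le> (exp x / 2) powr (- c)"
        using c_pos by (intro powr_mono2') auto
      also have "\<dots> = 2 powr c * exp (- (c * x))"
        by (simp add: powr_divide powr_minus exp_powr_real exp_minus field_simps)
      finally show ?thesis .
    qed
    have "x ^ (l - 1) * cosh x powr (- c) \<le> 2 powr c * (x ^ (l - 1) * exp (- (c * x)))" if "x > 0" for x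
      using mult_left_mono[OF bound[of x], of "x ^ (l - 1)"] that by (simp only: mult.left_commute) simp
    then show "AE x in lborel. norm (?f x)
        \<le> norm (indicator {0<..} x *\<^sub>R (2 powr c * (x ^ (l - 1) * exp (- (c * x)))))"
      by (auto simp: indicator_def)
  qed measurable
  have nn: "AE x in lborel. 0 \<le> ?f x" by (auto simp: indicator_def)
  have "integral\<^sup>L lborel ?f \<noteq> 0"
  proof
    assume "integral\<^sup>L lborel ?f = 0"
    then have "AE x in lborel. ?f x = 0"
      using integral_nonneg_eq_0_iff_AE[OF int nn] by simp
    then have "AE x in lborel. x \<notin> {0<..<1::real}"
      by eventually_elim (auto simp: indicator_def)
    then have "{0<..<1::real} \<in> null_sets lborel"
      by (subst AE_iff_null_sets) auto
    then show False by (simp add: null_sets_def)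
  qed
  moreover have "integral\<^sup>L lborel ?f \<ge> 0" using nn by (rule integral_nonneg_AE)
  ultimately show ?thesis unfolding orrw_J_eq set_lebesgue_integral_def by linarith
qed

text \<open>The Tauberian theorem with exponent l / 2 gives the constant 2^(-l/2) * l / Gamma (l / 2
  + 1). The functional equation of Gamma cancels l up to a factor 2, which lowers the exponent of 2
  in the denominator from l / 2 to (l - 2) / 2.\<close>

lemma moment_limit:
  assumes l: "l \<ge> 1"
  shows "(\<lambda>n. expectation (\<lambda>\<omega>. (real (running_max X n \<omega>) / sqrt (real n)) ^ l))
    \<longlonglongrightarrow> 1 / (2 powr ((real l - 2) / 2) * Gamma (real l / 2)) * orrw_J l c"
proof -
  have "(\<lambda>n. (\<Sum>k\<le>n. moment_increment l k) / real n powr (real l / 2)) \<longlonglongrightarrow>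
      (1 / 2) powr (real l / 2) * (real l * orrw_J l c) / Gamma (real l / 2 + 1)"
    unfolding orrw_J_eq using l
    by (intro karamata_tauberian moment_increment_nonneg summable_moment_increment moment_laplace_limit) auto
  moreover have "(\<Sum>k\<le>n. moment_increment l k) / real n powr (real l / 2)
      = expectation (\<lambda>\<omega>. (real (running_max X n \<omega>) / sqrt (real n)) ^ l)" for n
  proof -
    have "real n powr (real l / 2) = sqrt (real n) ^ l"
    proof (cases "n = 0")
      case False
      then have "sqrt (real n) ^ l = (real n powr (1 / 2)) powr real l"
        by (simp add: powr_half_sqrt powr_realpow)
      then show ?thesis by (simp add: powr_powr)
    qed (use l in simp)
    then show ?thesis unfolding sum_moment_increment[OF l] by (simp add: power_divide)
  qed
  moreover have "(1 / 2) powr (real l / 2) * (real l * orrw_J l c) / Gamma (real l / 2 + 1)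
      = 1 / (2 powr ((real l - 2) / 2) * Gamma (real l / 2)) * orrw_J l c"
  proof -
    have G: "Gamma (real l / 2 + 1) = real l / 2 * Gamma (real l / 2)"
      using l by (intro Gamma_plus1) (auto elim!: nonpos_Ints_cases)
    have P: "2 powr ((real l - 2) / 2) = 2 powr (real l / 2) / 2"
      by (simp add: diff_divide_distrib powr_diff)
    have "real l / 2 > 0" using l by simp
    then have "Gamma (real l / 2) \<noteq> 0" by (rule less_imp_neq[OF Gamma_real_pos, symmetric])
    then show ?thesis unfolding G P using l by (simp add: powr_divide)
  qed
  ultimately show ?thesis by simp
qed

end

theorem theorem1p1:
  fixes M :: "'a measure" and X :: "nat \<Rightarrow> 'a \<Rightarrow> nat" and c :: real
  assumes "c > 0"
    and "once_reinforced_walk M X c"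
  shows "(\<forall>l::nat. l \<ge> 1 \<longrightarrow>
            (\<lambda>n. \<integral>\<omega>. (real (running_max X n \<omega>) / sqrt (real n)) ^ l \<partial>M)
              \<sim>[at_top] (\<lambda>n. 1 / (2 powr ((real l - 2) / 2) * Gamma (real l / 2)) * orrw_J l c))
       \<and> (\<lambda>n. \<integral>\<omega>. real (running_max X n \<omega>) / sqrt (real n) \<partial>M)
            \<sim>[at_top] (\<lambda>n. sqrt (2 / pi) * orrw_J 1 c)
       \<and> (\<lambda>n. \<integral>\<omega>. (real (running_max X n \<omega>))\<^sup>2 / real n \<partial>M)
            \<sim>[at_top] (\<lambda>n. orrw_J 2 c)"
proof -
  interpret once_reinforced_walk M X c by fact
  have *: "(\<lambda>n. \<integral>\<omega>. (real (running_max X n \<omega>) / sqrt (real n)) ^ l \<partial>M)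
      \<sim>[at_top] (\<lambda>n. 1 / (2 powr ((real l - 2) / 2) * Gamma (real l / 2)) * orrw_J l c)"
    if l: "l \<ge> 1" for l
  proof (rule asymp_equivI')
    let ?L = "1 / (2 powr ((real l - 2) / 2) * Gamma (real l / 2)) * orrw_J l c"
    have "?L > 0" using orrw_J_pos[OF l] Gamma_real_pos[of "real l / 2"] l by simp
    then have nz: "?L \<noteq> 0" by (rule less_imp_neq[symmetric])
    show "((\<lambda>n. (\<integral>\<omega>. (real (running_max X n \<omega>) / sqrt (real n)) ^ l \<partial>M) / ?L) \<longlongrightarrow> 1) at_top"
      using tendsto_divide[OF moment_limit[OF l] tendsto_const nz] unfolding divide_self[OF nz] .
  qed
  \<comment> \<open>For l = 1 the value Gamma (1 / 2) = sqrt pi enters; for l = 2 the power of 2 and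
    Gamma 1 are both 1.\<close>
  have "1 / (2 powr ((real 1 - 2) / 2) * Gamma (real 1 / 2)) = sqrt (2 / pi)"
    by (simp add: Gamma_one_half_real powr_minus powr_half_sqrt real_sqrt_divide field_simps)
  moreover have "1 / (2 powr ((real 2 - 2) / 2) * Gamma (real 2 / 2)) = 1" by simp
  ultimately show ?thesis
    using * *[of 1] *[of 2] by (simp add: power_divide)
qed

end
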